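(* Let $\Phi_{\mathsf{unb}}$ be any set of graph specifications which contains a specification that is satisfied by every labelled graph (of arbitrary size, arbitrary degree and with arbitrary labels), e.g. the specification $\mathsf{true}$. Let $\Psi_{\mathsf{class}}$ be the set of output specifications of the form $\bigvee_{i\in I}\bigwedge_{j\in I\setminus\{i\}} x_i > x_j$, where $I$ is a finite set of indices of output coordinates. Then $\mathrm{ARP}_{\mathsf{graph}}(\Phi_{\mathsf{unb}},\Psi_{\mathsf{class}})$ is not formally verifiable; that is, there is no algorithm which, given a graph-classifier MPNN $N$, $\varphi\in\Phi_{\mathsf{unb}}$ and $\psi\in\Psi_{\mathsf{class}}$, always correctly decides whether for all graphs $G$ satisfying $\varphi$ the vector $N(G)$ satisfies $\psi$.
   Context: Graphs: a graph is a triple $G=(V,D,L)$ with $V$ a finite set of nodes, $D\subseteq V^2$ a symmetric set of edges and $L: V \to \mathbb{R}^n$ a labelling function. The neighbourhood of $v$ is $\mathrm{Neigh}(v)=\{v' \mid (v,v')\in D\}$; the degree of $G$ is the least $d\in\mathbb{N}$ with $|\mathrm{Neigh}(v)|\le d$ for all $v$. Neural networks (NN): feed-forward networks using the ReLU activation $\mathrm{re}(x)=\max(0,x)$ across all layers (each layer is an affine map followed by componentwise ReLU), with rational weights and biases, so that they can be given as input to an algorithm. Graph-classifier MPNN: it consists of layers $l_1,\dots,l_k$ given by NN $N_1,\dots,N_k$ and a readout NN $N_r$ (dimensions matching). On a graph $G=(V,D,L)$ it computes $\boldsymbol{x}^0_v = L(v)$, $\boldsymbol{x}^i_v = N_i\bigl(\boldsymbol{x}^{i-1}_v,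 \sum_{v'\in \mathrm{Neigh}(v)} \boldsymbol{x}^{i-1}_{v'}\bigr)$ for $1\le i\le k$, and outputs $N(G) = N_r\bigl(\sum_{v\in V}\boldsymbol{x}^k_v\bigr)$. Specifications: a graph specification $\varphi$ defines a set of graphs, and $G$ satisfies $\varphi$ if it belongs to this set; an output specification $\psi$ defines a set of vectors. The adversarial robustness property (ARP) $(N,\varphi,\psi)$ holds iff for all inputs $G$ satisfying $\varphi$ the output $N(G)$ satisfies $\psi$. $\mathrm{ARP}_{\mathsf{graph}}(\Phi,\Psi)$ is the set of all ARP $(N,\varphi,\psi)$ with $N$ a graph-classifier MPNN, $\varphi\in\Phi$, $\psi\in\Psi$. A set of properties is formally verifiable if it is decidable, given a property from the set, whether it holds. *)

theory Defs
  imports "Jordan_Normal_Form.Matrix" "HOL-Library.Nat_Bijection" "HOL-Library.FuncSet"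
begin

subsection \<open>Graphs\<close>

record 'v graph =
  nodes :: "'v set"
  edges :: "('v \<times> 'v) set"
  label :: "'v \<Rightarrow> real vec"

definition labelled_graph :: "nat \<Rightarrow> 'v graph \<Rightarrow> bool" where
  "labelled_graph n G \<longleftrightarrow>
     0 < n \<and> finite (nodes G) \<and> edges G \<subseteq> nodes G \<times> nodes G \<and> sym (edges G) \<and>
     label G \<in> nodes G \<rightarrow>\<^sub>E carrier_vec n"

definition neigh :: "'v graph \<Rightarrow> 'v \<Rightarrow> 'v set" where
  "neigh G v = {v'. (v, v') \<in> edges G}"


subsection \<open>Neural networks\<close>

type_synonym layer = "rat mat \<times> rat vec"
type_synonym nn = "layer list"

definition nn_in :: "nn \<Rightarrow> nat" where
  "nn_in N = dim_col (fst (hd N))"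

definition nn_out :: "nn \<Rightarrow> nat" where
  "nn_out N = dim_row (fst (last N))"

definition is_nn :: "nn \<Rightarrow> bool" where
  "is_nn N \<longleftrightarrow> N \<noteq> [] \<and>
     (\<forall>(A, b) \<in> set N. 0 < dim_row A \<and> 0 < dim_col A \<and> dim_vec b = dim_row A) \<and>
     successively (\<lambda>l l'. dim_col (fst l') = dim_row (fst l)) N"

definition relu :: "real \<Rightarrow> real" where
  "relu x = max 0 x"

definition layer_eval :: "layer \<Rightarrow> real vec \<Rightarrow> real vec" where
  "layer_eval l x =
     map_vec relu (map_mat of_rat (fst l) *\<^sub>v x + map_vec of_rat (snd l))"

definition nn_eval :: "nn \<Rightarrow> real vec \<Rightarrow> real vec" where
  "nn_eval N = fold layer_eval N"


subsection \<open>Graph-classifier MPNN\<close>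

text \<open>The networks of the message-passing layers, in order of application, and the readout.\<close>

type_synonym mpnn = "nn list \<times> nn"

text \<open>
  A message-passing layer reads the concatenation of two vectors of the same dimension, so its
  network has twice the dimension of the node states as input dimension.
\<close>

definition is_mpnn :: "mpnn \<Rightarrow> bool" where
  "is_mpnn N \<longleftrightarrow> (case N of (Ns, R) \<Rightarrow>
     Ns \<noteq> [] \<and> (\<forall>M \<in> set Ns. is_nn M) \<and> is_nn R \<and> even (nn_in (hd Ns)) \<and>
     successively (\<lambda>M M'. nn_in M' = 2 * nn_out M) Ns \<and> nn_in R = nn_out (last Ns))"

definition mpnn_in :: "mpnn \<Rightarrow> nat" where
  "mpnn_in N = nn_in (hd (fst N)) div 2"

definition mpnn_out :: "mpnn \<Rightarrow> nat" where
  "mpnn_out N = nn_out (snd N)"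

definition mp_step :: "'v graph \<Rightarrow> nn \<Rightarrow> ('v \<Rightarrow> real vec) \<Rightarrow> 'v \<Rightarrow> real vec" where
  "mp_step G M x v =
     nn_eval M (x v @\<^sub>v finsum_vec TYPE(real) (nn_in M div 2) x (neigh G v))"

definition mpnn_eval :: "mpnn \<Rightarrow> 'v graph \<Rightarrow> real vec" where
  "mpnn_eval N G = (case N of (Ns, R) \<Rightarrow>
     nn_eval R (finsum_vec TYPE(real) (nn_in R) (fold (mp_step G) Ns (label G)) (nodes G)))"


subsection \<open>Adversarial robustness properties\<close>

text \<open>
  Specifications are syntactic objects; the functions \<open>gsem\<close> and \<open>osem\<close> below assign to a
  specification the set of graphs, respectively vectors, that it defines. A set \<open>\<Psi>\<close> of output
  specifications is indexed by the dimension of the vectors it speaks about.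
\<close>

definition ARP_graph :: "'s set \<Rightarrow> (nat \<Rightarrow> 'o set) \<Rightarrow> (mpnn \<times> 's \<times> 'o) set" where
  "ARP_graph \<Phi> \<Psi> = {(N, \<phi>, \<psi>). is_mpnn N \<and> \<phi> \<in> \<Phi> \<and> \<psi> \<in> \<Psi> (mpnn_out N)}"

definition arp_holds ::
  "('s \<Rightarrow> 'v graph set) \<Rightarrow> ('o \<Rightarrow> real vec set) \<Rightarrow> mpnn \<times> 's \<times> 'o \<Rightarrow> bool" where
  "arp_holds gsem osem P = (case P of (N, \<phi>, \<psi>) \<Rightarrow>
     \<forall>G. labelled_graph (mpnn_in N) G \<longrightarrow> G \<in> gsem \<phi> \<longrightarrow> mpnn_eval N G \<in> osem \<psi>)"

text \<open>
  A classification specification is given by its finite set of coordinates \<open>I\<close>; it stands for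
  the disjunction over \<open>i \<in> I\<close> of the conjunctions, over the other \<open>j \<in> I\<close>, of \<open>x\<^sub>i > x\<^sub>j\<close>.
  Coordinates are counted from 0.
\<close>

definition \<Psi>_class :: "nat \<Rightarrow> nat set set" where
  "\<Psi>_class m = {I. finite I \<and> I \<subseteq> {..<m}}"

definition class_sem :: "nat set \<Rightarrow> real vec set" where
  "class_sem I = {x. \<exists>i \<in> I. \<forall>j \<in> I - {i}. x $ i > x $ j}"


subsection \<open>Decidability\<close>

text \<open>
  Partial recursive functions. The arity is not part of the syntax: a term is applied to an
  argument list, and there is no result if the length of the list does not fit. The number that
  \<open>PrimRec\<close> recurses on and the number that \<open>Mu\<close> searches for come first in the argument list.
\<close>

datatype recf =
    Zero
  | Succ
  | Proj nat
  | Comp recf "recf list"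
  | PrimRec recf recf
  | Mu recf

inductive evaluates :: "recf \<Rightarrow> nat list \<Rightarrow> nat \<Rightarrow> bool" where
  zero: "evaluates Zero xs 0"
| succ: "evaluates Succ [x] (Suc x)"
| proj: "i < length xs \<Longrightarrow> evaluates (Proj i) xs (xs ! i)"
| comp: "list_all2 (\<lambda>g y. evaluates g xs y) gs ys \<Longrightarrow> evaluates f ys z \<Longrightarrow>
           evaluates (Comp f gs) xs z"
| rec_0: "evaluates f xs y \<Longrightarrow> evaluates (PrimRec f g) (0 # xs) y"
| rec_Suc: "evaluates (PrimRec f g) (n # xs) r \<Longrightarrow> evaluates g (n # r # xs) y \<Longrightarrow>
              evaluates (PrimRec f g) (Suc n # xs) y"
| mu: "evaluates f (n # xs) 0 \<Longrightarrow> (\<And>m. m < n \<Longrightarrow> \<exists>y. evaluates f (m # xs) (Suc y)) \<Longrightarrow>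
         evaluates (Mu f) xs n"

lemma evaluates_deterministic:
  "evaluates f xs y \<Longrightarrow> evaluates f xs z \<Longrightarrow> y = z"
proof (induction arbitrary: z rule: evaluates.induct)
  case (comp xs gs ys f w)
  from comp.prems obtain ys' where
    ys': "list_all2 (\<lambda>g y. evaluates g xs y) gs ys'" "evaluates f ys' z"
    by (cases rule: evaluates.cases) auto
  have "ys = ys'"
    using comp.IH(1) ys'(1) by (auto simp: list_all2_conv_all_nth intro!: nth_equalityI)
  then show ?case using comp.IH(2) ys'(2) by simp
next
  case (rec_Suc f g n xs r y)
  from rec_Suc.prems obtain r' where
    "evaluates (PrimRec f g) (n # xs) r'" "evaluates g (n # r' # xs) z"
    by (cases rule: evaluates.cases) auto
  then show ?case using rec_Suc.IH by blast
next
  case (mu f n xs)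
  from mu.prems have z: "evaluates f (z # xs) 0"
      "\<And>m. m < z \<Longrightarrow> \<exists>y. evaluates f (m # xs) (Suc y)"
    by (cases rule: evaluates.cases; auto)+
  have "\<not> n < z" using mu.IH(1) z(2) by (metis nat.distinct(1))
  moreover have "\<not> z < n" using mu.IH(2) z(1) by (metis nat.distinct(1))
  ultimately show ?case by simp
qed (erule evaluates.cases; auto)+

text \<open>
  Instances are handed to the algorithm as numbers. It only has to be correct on \<open>A\<close>; on other
  numbers it may return anything or diverge.
\<close>

definition decidable_on :: "('a \<Rightarrow> nat) \<Rightarrow> 'a set \<Rightarrow> ('a \<Rightarrow> bool) \<Rightarrow> bool" where
  "decidable_on code A P \<longleftrightarrow>
     (\<exists>f. \<forall>a \<in> A. evaluates f [code a] (if P a then 1 else 0))"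


subsection \<open>Coding of instances\<close>

definition rat_code :: "rat \<Rightarrow> nat" where
  "rat_code q = (case quotient_of q of (a, b) \<Rightarrow> prod_encode (int_encode a, nat b))"

definition layer_code :: "layer \<Rightarrow> nat" where
  "layer_code l = prod_encode
     (list_encode (map (\<lambda>row. list_encode (map rat_code row)) (mat_to_list (fst l))),
      list_encode (map rat_code (list_of_vec (snd l))))"

definition nn_code :: "nn \<Rightarrow> nat" where
  "nn_code N = list_encode (map layer_code N)"

definition mpnn_code :: "mpnn \<Rightarrow> nat" where
  "mpnn_code N = prod_encode (list_encode (map nn_code (fst N)), nn_code (snd N))"

definition arp_code :: "('s \<Rightarrow> nat) \<Rightarrow> ('o \<Rightarrow> nat) \<Rightarrow> mpnn \<times> 's \<times> 'o \<Rightarrow> nat" where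
  "arp_code gcode ocode P = (case P of (N, \<phi>, \<psi>) \<Rightarrow>
     prod_encode (mpnn_code N, prod_encode (gcode \<phi>, ocode \<psi>)))"

text \<open>
  The codings \<open>gcode\<close> and \<open>ocode\<close> of the specifications are parameters, since the syntax of
  the specifications is left open.
\<close>

definition formally_verifiable ::
  "('s \<Rightarrow> 'v graph set) \<Rightarrow> ('s \<Rightarrow> nat) \<Rightarrow> ('o \<Rightarrow> real vec set) \<Rightarrow> ('o \<Rightarrow> nat) \<Rightarrow>
     (mpnn \<times> 's \<times> 'o) set \<Rightarrow> bool" where
  "formally_verifiable gsem gcode osem ocode A \<longleftrightarrow>
     decidable_on (arp_code gcode ocode) A (arp_holds gsem osem)"

lemma inj_rat_code: "inj rat_code"
proof (rule injI)
  fix p q :: rat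
  assume eq: "rat_code p = rat_code q"
  obtain a b where p: "quotient_of p = (a, b)" by fastforce
  obtain c d where q: "quotient_of q = (c, d)" by fastforce
  have "0 < b" "0 < d" using p q quotient_of_denom_pos by blast+
  then have "quotient_of p = quotient_of q"
    using eq p q by (auto simp: rat_code_def dest!: injD[OF inj_int_encode])
  then show "p = q" by (simp add: quotient_of_inject)
qed

lemma map_rat_code_eq_iff: "map rat_code xs = map rat_code ys \<longleftrightarrow> xs = ys"
  using inj_rat_code by (simp add: inj_map_eq_map)

lemma inj_on_layer_code: "inj_on layer_code {l. 0 < dim_row (fst l)}"
proof (rule inj_onI, clarsimp)
  fix A B :: "rat mat" and b c :: "rat vec"
  assume A: "0 < dim_row A" and eq: "layer_code (A, b) = layer_code (B, c)"
  have inj: "inj (\<lambda>row. list_encode (map rat_code row))"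
    by (rule injI) (simp add: list_encode_eq map_rat_code_eq_iff)
  from eq have AB: "mat_to_list A = mat_to_list B" and bc: "list_of_vec b = list_of_vec c"
    by (auto simp: layer_code_def list_encode_eq map_rat_code_eq_iff inj_map_eq_map[OF inj])
  have rows: "dim_row A = dim_row B"
    using arg_cong[OF AB, of length] by (simp add: mat_to_list_def)
  have cols: "dim_col A = dim_col B"
    using arg_cong[OF AB, of "\<lambda>xs. length (xs ! 0)"] A rows by (simp add: mat_to_list_def)
  have "A $$ (i, j) = B $$ (i, j)" if "i < dim_row A" "j < dim_col A" for i j
    using arg_cong[OF AB, of "\<lambda>xs. xs ! i ! j"] that rows cols by (simp add: mat_to_list_def)
  then have "A = B" using rows cols by (intro eq_matI) auto
  moreover have "b = c" using bc by (metis vec_list)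
  ultimately show "A = B \<and> b = c" by simp
qed

lemma inj_on_nn_code: "inj_on nn_code {N. is_nn N}"
proof (rule inj_onI, clarsimp)
  fix M N assume MN: "is_nn M" "is_nn N" "nn_code M = nn_code N"
  then have "set M \<union> set N \<subseteq> {l. 0 < dim_row (fst l)}" by (auto simp: is_nn_def)
  then have "inj_on layer_code (set M \<union> set N)"
    using inj_on_layer_code by (rule inj_on_subset[rotated])
  then show "M = N" using MN(3) by (simp add: nn_code_def list_encode_eq inj_on_map_eq_map)
qed

lemma inj_on_mpnn_code: "inj_on mpnn_code {N. is_mpnn N}"
proof (rule inj_onI, clarsimp)
  fix Ms Ns R S
  assume M: "is_mpnn (Ms, R)" and N: "is_mpnn (Ns, S)"
    and eq: "mpnn_code (Ms, R) = mpnn_code (Ns, S)"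
  have sub: "set Ms \<union> set Ns \<subseteq> {N. is_nn N}" "is_nn R" "is_nn S"
    using M N by (auto simp: is_mpnn_def)
  have "R = S"
    using eq sub(2,3) inj_on_nn_code by (auto simp: mpnn_code_def inj_on_def)
  moreover have "inj_on nn_code (set Ms \<union> set Ns)"
    using sub(1) inj_on_nn_code by (rule inj_on_subset[rotated])
  ultimately show "Ms = Ns \<and> R = S" using eq by (simp add: mpnn_code_def list_encode_eq inj_on_map_eq_map)
qed

end

theory Submission
  imports Defs
begin

text \<open>
  Recursive functions are simulated by programs with finitely many registers, whose steps are
  piecewise linear. A halting run is written down as a path of nodes labelled with configurations,
  and one message-passing layer can measure, by a nonnegative piecewise linear function, how far
  every node is from having a correct successor. The readout adds up these violations together with
  the deviation of the initial register from a number \<open>n\<close> that occurs as a bias, and emits the total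
  and the constant 0. Some graph gives two equal outputs iff the program halts on \<open>n\<close>, that is, iff
  the output specification for the coordinates 0 and 1 fails.

  The program can be applied to the code of its own message-passing layer, because the code of an
  instance is computable from the codes of the layer and of \<open>n\<close>. The program that runs a decision
  procedure on the resulting instance, and halts iff the answer is that the property holds, refutes
  the procedure.
\<close>

subsection \<open>Piecewise linear functions as ReLU networks\<close>

inductive_set pl :: "nat \<Rightarrow> (real vec \<Rightarrow> real) set" for n where
  coord: "i < n \<Longrightarrow> (\<lambda>x. x $ i) \<in> pl n"
| const: "(\<lambda>_. of_rat q) \<in> pl n"
| add: "f \<in> pl n \<Longrightarrow> g \<in> pl n \<Longrightarrow> (\<lambda>x. f x + g x) \<in> pl n"
| scale: "f \<in> pl n \<Longrightarrow> (\<lambda>x. of_rat q * f x) \<in> pl n"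
| relu: "f \<in> pl n \<Longrightarrow> (\<lambda>x. relu (f x)) \<in> pl n"

definition outputs :: "(real vec \<Rightarrow> real) list \<Rightarrow> real vec \<Rightarrow> real vec" where
  "outputs fs x = vec_of_list (map (\<lambda>f. f x) fs)"

lemma dim_outputs [simp]: "dim_vec (outputs fs x) = length fs"
  by (simp add: outputs_def)

lemma index_outputs [simp]: "i < length fs \<Longrightarrow> outputs fs x $ i = (fs ! i) x"
  by (simp add: outputs_def vec_of_list_index)

definition realizes :: "nn \<Rightarrow> nat \<Rightarrow> (real vec \<Rightarrow> real) list \<Rightarrow> bool" where
  "realizes N n fs \<longleftrightarrow> is_nn N \<and> nn_in N = n \<and> nn_out N = length fs \<and>
     (\<forall>x \<in> carrier_vec n. nn_eval N x = outputs fs x)"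

text \<open>These are the functions that a unit reading the wires \<open>fs\<close> can form before
  its ReLU is applied.\<close>

definition affine_in :: "nat \<Rightarrow> (real vec \<Rightarrow> real) list \<Rightarrow> (real vec \<Rightarrow> real) \<Rightarrow> bool" where
  "affine_in n fs g \<longleftrightarrow> (\<exists>c b. \<forall>x \<in> carrier_vec n.
     g x = (\<Sum>i<length fs. of_rat (c i) * (fs ! i) x) + of_rat b)"

lemma affine_in_append:
  assumes "affine_in n fs g" shows "affine_in n (fs @ hs) g"
proof -
  obtain c b where c: "\<And>x. x \<in> carrier_vec n \<Longrightarrow>
      g x = (\<Sum>i<length fs. of_rat (c i) * (fs ! i) x) + of_rat b"
    using assms by (auto simp: affine_in_def)
  define c' where "c' i = (if i < length fs then c i else 0)" for i
  have "(\<Sum>i<length (fs @ hs). of_rat (c' i) * ((fs @ hs) ! i) x) =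
      (\<Sum>i<length fs. of_rat (c i) * (fs ! i) x)" for x
    by (rule sum.mono_neutral_cong_right) (auto simp: c'_def nth_append)
  then show ?thesis
    using c unfolding affine_in_def by (intro exI[of _ c'] exI[of _ b]) simp
qed

lemma affine_in_nth:
  assumes "i < length fs" shows "affine_in n fs (fs ! i)"
proof -
  have "(\<Sum>j<length fs. of_rat (if j = i then 1 else 0) * (fs ! j) x) = (fs ! i) x" for x
  proof -
    have "(\<Sum>j<length fs. of_rat (if j = i then 1 else 0) * (fs ! j) x) =
        (\<Sum>j<length fs. if j = i then (fs ! j) x else 0)"
      by (rule sum.cong) auto
    then show ?thesis using assms by simp
  qed
  then show ?thesis
    unfolding affine_in_def by (intro exI[of _ "\<lambda>j. if j = i then 1 else 0"] exI[of _ 0]) simp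
qed

lemma affine_in_const: "affine_in n fs (\<lambda>_. of_rat q)"
  unfolding affine_in_def by (intro exI[of _ "\<lambda>_. 0"] exI[of _ q]) simp

lemma affine_in_add:
  assumes "affine_in n fs f" "affine_in n fs g" shows "affine_in n fs (\<lambda>x. f x + g x)"
proof -
  obtain c b c' b' where "\<And>x. x \<in> carrier_vec n \<Longrightarrow>
      f x = (\<Sum>i<length fs. of_rat (c i) * (fs ! i) x) + of_rat b"
    "\<And>x. x \<in> carrier_vec n \<Longrightarrow>
      g x = (\<Sum>i<length fs. of_rat (c' i) * (fs ! i) x) + of_rat b'"
    using assms by (auto simp: affine_in_def)
  then show ?thesis
    unfolding affine_in_def
    by (intro exI[of _ "\<lambda>i. c i + c' i"] exI[of _ "b + b'"])
      (simp add: of_rat_add distrib_right sum.distrib)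
qed

lemma affine_in_scale:
  assumes "affine_in n fs f" shows "affine_in n fs (\<lambda>x. of_rat q * f x)"
proof -
  obtain c b where "\<And>x. x \<in> carrier_vec n \<Longrightarrow>
      f x = (\<Sum>i<length fs. of_rat (c i) * (fs ! i) x) + of_rat b"
    using assms by (auto simp: affine_in_def)
  then show ?thesis
    unfolding affine_in_def
    by (intro exI[of _ "\<lambda>i. q * c i"] exI[of _ "q * b"])
      (simp add: of_rat_mult distrib_left sum_distrib_left mult.assoc)
qed

lemma relu_nonneg [simp]: "0 \<le> relu x" and relu_id [simp]: "0 \<le> x \<Longrightarrow> relu x = x"
  by (auto simp: relu_def)

lemma ex_layer:
  assumes "\<And>g. g \<in> set gs \<Longrightarrow> affine_in n fs g"
  obtains l where "dim_row (fst l) = length gs" "dim_col (fst l) = length fs"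
    "dim_vec (snd l) = length gs"
    "\<And>x. x \<in> carrier_vec n \<Longrightarrow> layer_eval l (outputs fs x) = outputs (map (\<lambda>g x. relu (g x)) gs) x"
proof -
  have "\<forall>i<length gs. \<exists>c b. \<forall>x \<in> carrier_vec n.
      (gs ! i) x = (\<Sum>j<length fs. of_rat (c j) * (fs ! j) x) + of_rat b"
    using assms unfolding affine_in_def by simp
  then obtain c b where cb: "\<And>i x. i < length gs \<Longrightarrow> x \<in> carrier_vec n \<Longrightarrow>
      (gs ! i) x = (\<Sum>j<length fs. of_rat (c i j) * (fs ! j) x) + of_rat (b i)"
    by metis
  let ?l = "(mat (length gs) (length fs) (\<lambda>(i, j). c i j), vec (length gs) b)"
  have "layer_eval ?l (outputs fs x) = outputs (map (\<lambda>g x. relu (g x)) gs) x"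
    if "x \<in> carrier_vec n" for x
    using that
    by (intro eq_vecI)
      (auto simp: layer_eval_def scalar_prod_def cb atLeast0LessThan intro!: arg_cong[of _ _ relu] sum.cong)
  then show ?thesis by (intro that[of ?l]) auto
qed

lemma realizes_snoc:
  assumes N: "realizes N n fs" and gs: "gs \<noteq> []" "\<And>g. g \<in> set gs \<Longrightarrow> affine_in n fs g"
  shows "\<exists>l. realizes (N @ [l]) n (map (\<lambda>g x. relu (g x)) gs)"
proof -
  have N': "is_nn N" "nn_in N = n" "nn_out N = length fs" "N \<noteq> []"
    using N by (auto simp: realizes_def is_nn_def)
  \<comment> \<open>\<open>is_nn\<close> forbids empty dimensions, and this is the number of columns
    of the new layer.\<close>
  have "0 < length fs"
    using N' last_in_set[of N] unfolding is_nn_def nn_out_def by (metis (no_types, lifting) case_prodD prod.collapse)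
  obtain l where l: "dim_row (fst l) = length gs" "dim_col (fst l) = length fs"
    "dim_vec (snd l) = length gs"
    "\<And>x. x \<in> carrier_vec n \<Longrightarrow> layer_eval l (outputs fs x) = outputs (map (\<lambda>g x. relu (g x)) gs) x"
    using ex_layer[OF gs(2)] by metis
  have "realizes (N @ [l]) n (map (\<lambda>g x. relu (g x)) gs)"
    using N N' l \<open>0 < length fs\<close> gs(1)
    by (auto simp: realizes_def is_nn_def nn_in_def nn_out_def nn_eval_def successively_append_iff)
  then show ?thesis by blast
qed

text \<open>Nonnegative wires can be passed on unchanged by the ReLU units of later layers.\<close>

definition spans_inputs :: "nat \<Rightarrow> (real vec \<Rightarrow> real) list \<Rightarrow> bool" where
  "spans_inputs n fs \<longleftrightarrow> (\<forall>i<n. affine_in n fs (\<lambda>x. x $ i)) \<and> (\<forall>f \<in> set fs. \<forall>x. 0 \<le> f x)"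

lemma spans_inputs_append:
  "spans_inputs n fs \<Longrightarrow> (\<forall>f \<in> set hs. \<forall>x. 0 \<le> f x) \<Longrightarrow> spans_inputs n (fs @ hs)"
  by (auto simp: spans_inputs_def intro: affine_in_append)

text \<open>Wires are only ever appended: while the network for the second summand is built, those
  serving the first stay available, so summands of different depth can be added. Only a ReLU costs a
  layer; sums and multiples are absorbed by the affine combination.\<close>

lemma pl_realizable_extend:
  assumes "f \<in> pl n" "realizes N n fs" "spans_inputs n fs"
  shows "\<exists>N' hs. realizes N' n (fs @ hs) \<and> spans_inputs n (fs @ hs) \<and> affine_in n (fs @ hs) f"
  using assms
proof (induction f arbitrary: N fs)
  case (coord i)
  then show ?case by (intro exI[of _ N] exI[of _ "[]"]) (simp add: spans_inputs_def)
next
  case (const q)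
  then show ?case by (intro exI[of _ N] exI[of _ "[]"]) (simp add: affine_in_const)
next
  case (add f g)
  obtain N1 hs1 where 1: "realizes N1 n (fs @ hs1)" "spans_inputs n (fs @ hs1)"
      "affine_in n (fs @ hs1) f"
    using add.IH(1)[OF add.prems] by blast
  obtain N2 hs2 where 2: "realizes N2 n ((fs @ hs1) @ hs2)" "spans_inputs n ((fs @ hs1) @ hs2)"
      "affine_in n ((fs @ hs1) @ hs2) g"
    using add.IH(2)[OF 1(1,2)] by blast
  have "affine_in n ((fs @ hs1) @ hs2) (\<lambda>x. f x + g x)"
    using affine_in_append[OF 1(3)] 2(3) by (rule affine_in_add)
  then show ?case
    using 2 by (intro exI[of _ N2] exI[of _ "hs1 @ hs2"]) simp
next
  case (scale f q)
  then show ?case using affine_in_scale by metis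
next
  case (relu f)
  obtain N1 hs1 where 1: "realizes N1 n (fs @ hs1)" "spans_inputs n (fs @ hs1)"
      "affine_in n (fs @ hs1) f"
    using relu.IH[OF relu.prems] by blast
  let ?gs = "(fs @ hs1) @ [f]"
  have "affine_in n (fs @ hs1) g" if "g \<in> set ?gs" for g
  proof (cases "g \<in> set (fs @ hs1)")
    case True
    then show ?thesis by (metis affine_in_nth in_set_conv_nth)
  next
    case False
    then show ?thesis using 1(3) that by auto
  qed
  then obtain l where l: "realizes (N1 @ [l]) n (map (\<lambda>g x. relu (g x)) ?gs)"
    using realizes_snoc[OF 1(1), of ?gs] by auto
  have "map (\<lambda>g x. relu (g x)) (fs @ hs1) = fs @ hs1"
    using 1(2) by (intro map_idI) (auto simp: spans_inputs_def)
  then have "map (\<lambda>g x. relu (g x)) ?gs = (fs @ hs1) @ [\<lambda>x. relu (f x)]" by simp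
  moreover have "affine_in n ((fs @ hs1) @ [\<lambda>x. relu (f x)]) (\<lambda>x. relu (f x))"
    using affine_in_nth[of "length (fs @ hs1)" "(fs @ hs1) @ [\<lambda>x. relu (f x)]"]
    by (simp add: nth_append)
  moreover have "spans_inputs n ((fs @ hs1) @ [\<lambda>x. relu (f x)])"
    using 1(2) by (rule spans_inputs_append) simp
  ultimately show ?case
    using l by (intro exI[of _ "N1 @ [l]"] exI[of _ "hs1 @ [\<lambda>x. relu (f x)]"]) auto
qed

text \<open>The first layer splits each input into relu(x_i) and relu(-x_i), nonnegative wires whose
  difference is x_i. The functions are then made available one after another. The layer that outputs
  them applies ReLU too, hence the \<open>relu\<close> around each of them.\<close>

lemma pl_realizable:
  assumes "0 < n" "fs \<noteq> []" "set fs \<subseteq> pl n"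
  obtains N where "realizes N n (map (\<lambda>f x. relu (f x)) fs)"
proof -
  define xs :: "(real vec \<Rightarrow> real) list" where "xs = map (\<lambda>i x. x $ i) [0..<n]"
  have xs: "length xs = n" "\<And>i. i < n \<Longrightarrow> xs ! i = (\<lambda>x. x $ i)" by (auto simp: xs_def)
  define gs where "gs = xs @ map (\<lambda>f x. of_rat (- 1) * f x) xs"
  have xs_aff: "affine_in n xs g" if "g \<in> set xs" for g
    using that by (metis affine_in_nth in_set_conv_nth)
  have aff: "affine_in n xs g" if "g \<in> set gs" for g
    using that unfolding gs_def set_append set_map
    by (elim UnE imageE) (simp_all only: affine_in_scale xs_aff)
  obtain l where l: "dim_row (fst l) = length gs" "dim_col (fst l) = length xs"
    "dim_vec (snd l) = length gs"
    "\<And>x. x \<in> carrier_vec n \<Longrightarrow> layer_eval l (outputs xs x) = outputs (map (\<lambda>g x. relu (g x)) gs) x"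
    using ex_layer[OF aff] by metis
  have id: "outputs xs x = x" if "x \<in> carrier_vec n" for x
    using that xs by (intro eq_vecI) auto
  define hs where "hs = map (\<lambda>g x. relu (g x)) gs"
  have hs: "length hs = 2 * n" "\<And>i. i < n \<Longrightarrow> hs ! i = (\<lambda>x. relu (x $ i))"
    "\<And>i. i < n \<Longrightarrow> hs ! (n + i) = (\<lambda>x. relu (- (x $ i)))"
    using xs by (auto simp: hs_def gs_def nth_append)
  have base: "realizes [l] n hs"
    using l id \<open>0 < n\<close> xs
    by (cases l) (auto simp: realizes_def is_nn_def nn_in_def nn_out_def nn_eval_def hs_def gs_def)
  have "affine_in n hs (\<lambda>x. x $ i)" if "i < n" for i
  proof -
    have "affine_in n hs (\<lambda>x. (hs ! i) x + of_rat (- 1) * (hs ! (n + i)) x)"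
      using that hs(1) by (intro affine_in_add affine_in_scale affine_in_nth) auto
    moreover have "relu y - relu (- y) = y" for y by (auto simp: relu_def)
    ultimately show ?thesis using that by (simp add: hs)
  qed
  then have spans: "spans_inputs n hs" by (auto simp: spans_inputs_def hs_def)
  have "\<exists>N' ks. realizes N' n (hs @ ks) \<and> spans_inputs n (hs @ ks) \<and>
      (\<forall>f \<in> set fs. affine_in n (hs @ ks) f)"
    using assms(3)
  proof (induction fs)
    case Nil
    then show ?case using base spans by (intro exI[of _ "[l]"] exI[of _ "[]"]) simp
  next
    case (Cons f fs)
    then obtain N' ks where 1: "realizes N' n (hs @ ks)" "spans_inputs n (hs @ ks)"
        "\<forall>f \<in> set fs. affine_in n (hs @ ks) f" by auto
    have "f \<in> pl n" using Cons.prems by simp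
    from pl_realizable_extend[OF this 1(1,2)]
    obtain N2 ms where 2: "realizes N2 n ((hs @ ks) @ ms)" "spans_inputs n ((hs @ ks) @ ms)"
        "affine_in n ((hs @ ks) @ ms) f" by auto
    moreover have "\<forall>f \<in> set fs. affine_in n ((hs @ ks) @ ms) f"
      using 1(3) affine_in_append by blast
    ultimately show ?case
      by (intro exI[of _ N2] exI[of _ "ks @ ms"]) auto
  qed
  then obtain N' ks where N': "realizes N' n (hs @ ks)"
      and fs: "\<And>f. f \<in> set fs \<Longrightarrow> affine_in n (hs @ ks) f"
    by blast
  from realizes_snoc[OF N' assms(2) fs] show ?thesis using that by blast
qed

section \<open>Predicates as zero sets of nonnegative piecewise linear functions\<close>

definition pl_zero :: "nat \<Rightarrow> (real vec \<Rightarrow> bool) \<Rightarrow> bool" where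
  "pl_zero n Q \<longleftrightarrow> (\<exists>f \<in> pl n. \<forall>u. 0 \<le> f u \<and> (f u = 0 \<longleftrightarrow> Q u))"

lemma pl_diff: "f \<in> pl n \<Longrightarrow> g \<in> pl n \<Longrightarrow> (\<lambda>x. f x - g x) \<in> pl n"
  using pl.add[OF _ pl.scale[of g n "- 1"], of f] by simp

lemma pl_of_nat: "(\<lambda>_. of_nat m) \<in> pl n"
  using pl.const[of "of_nat m"] by simp

lemma pl_of_int: "(\<lambda>_. of_int z) \<in> pl n"
  using pl.const[of "of_int z"] by simp

lemma pl_0: "(\<lambda>_. 0) \<in> pl n" and pl_1: "(\<lambda>_. 1) \<in> pl n"
  using pl_of_nat[of 0] pl_of_nat[of 1] by simp_all

lemma pl_scale_int: "f \<in> pl n \<Longrightarrow> (\<lambda>x. of_int z * f x) \<in> pl n"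
  using pl.scale[of f n "of_int z"] by simp

lemma pl_abs: "f \<in> pl n \<Longrightarrow> (\<lambda>x. \<bar>f x\<bar>) \<in> pl n"
proof -
  assume f: "f \<in> pl n"
  have "(\<lambda>x. relu (f x) + relu (0 - f x)) \<in> pl n"
    by (intro pl.add pl.relu pl_diff pl_0 f)
  moreover have "relu y + relu (0 - y) = \<bar>y\<bar>" for y by (simp add: relu_def)
  ultimately show ?thesis by simp
qed

lemma pl_zero_le: "f \<in> pl n \<Longrightarrow> g \<in> pl n \<Longrightarrow> pl_zero n (\<lambda>u. f u \<le> g u)"
  unfolding pl_zero_def
  by (intro bexI[of _ "\<lambda>u. relu (f u - g u)"]) (auto simp: relu_def intro: pl.relu[unfolded relu_def] pl_diff)

lemma pl_zero_eq: "f \<in> pl n \<Longrightarrow> g \<in> pl n \<Longrightarrow> pl_zero n (\<lambda>u. f u = g u)"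
  unfolding pl_zero_def
  by (intro bexI[of _ "\<lambda>u. \<bar>f u - g u\<bar>"]) (auto intro: pl_abs pl_diff)

lemma pl_zero_const: "pl_zero n (\<lambda>_. b)"
  using pl_zero_eq[OF pl_0 pl_0] pl_zero_eq[OF pl_0 pl_1] by (cases b) auto

lemma pl_zero_conj:
  assumes "pl_zero n Q" "pl_zero n Q'" shows "pl_zero n (\<lambda>u. Q u \<and> Q' u)"
proof -
  obtain f g where "f \<in> pl n" "\<And>u. 0 \<le> f u" "\<And>u. f u = 0 \<longleftrightarrow> Q u"
    "g \<in> pl n" "\<And>u. 0 \<le> g u" "\<And>u. g u = 0 \<longleftrightarrow> Q' u"
    using assms by (auto simp: pl_zero_def)
  then show ?thesis unfolding pl_zero_def
    by (intro bexI[of _ "\<lambda>u. f u + g u"]) (auto simp: add_nonneg_eq_0_iff intro: pl.add)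
qed

lemma pl_zero_disj:
  assumes "pl_zero n Q" "pl_zero n Q'" shows "pl_zero n (\<lambda>u. Q u \<or> Q' u)"
proof -
  obtain f g where fg: "f \<in> pl n" "\<And>u. 0 \<le> f u" "\<And>u. f u = 0 \<longleftrightarrow> Q u"
    "g \<in> pl n" "\<And>u. 0 \<le> g u" "\<And>u. g u = 0 \<longleftrightarrow> Q' u"
    using assms by (auto simp: pl_zero_def)
  have min: "(\<lambda>u. min (f u) (g u)) \<in> pl n"
  proof -
    have "(\<lambda>u. f u - relu (f u - g u)) \<in> pl n" using fg by (intro pl.relu pl_diff)
    moreover have "f u - relu (f u - g u) = min (f u) (g u)" for u by (simp add: relu_def)
    ultimately show ?thesis by simp
  qed
  have "min (f u) (g u) = 0 \<longleftrightarrow> f u = 0 \<or> g u = 0" for u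
    using fg(2)[of u] fg(5)[of u] by linarith
  then show ?thesis unfolding pl_zero_def using fg
    by (intro bexI[OF _ min]) auto
qed

lemma pl_zero_ball:
  assumes "finite I" "\<And>i. i \<in> I \<Longrightarrow> pl_zero n (Q i)" shows "pl_zero n (\<lambda>u. \<forall>i \<in> I. Q i u)"
  using assms by (induction I) (auto intro: pl_zero_conj pl_zero_const)

lemma pl_zero_bex:
  assumes "finite I" "\<And>i. i \<in> I \<Longrightarrow> pl_zero n (Q i)" shows "pl_zero n (\<lambda>u. \<exists>i \<in> I. Q i u)"
  using assms by (induction I) (auto intro: pl_zero_disj pl_zero_const)

subsection \<open>Register programs simulating recursive functions\<close>

text \<open>One form of assignment covers clearing, copying, increment and decrement. On integers
  its truncation at 0 is ReLU, so it is piecewise linear in the registers. The list of commands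
  still to be run acts as program counter.\<close>

datatype com = Upd nat int nat int | While nat "com list"

type_synonym config = "com list \<times> (nat \<Rightarrow> nat)"

fun step :: "config \<Rightarrow> config" where
  "step ([], s) = ([], s)"
| "step (Upd r a r' i # k, s) = (k, s(r := nat (a * int (s r') + i)))"
| "step (While r b # k, s) = (if s r = 0 then k else b @ While r b # k, s)"

definition halts :: "config \<Rightarrow> bool" where
  "halts c \<longleftrightarrow> (\<exists>T. fst ((step ^^ T) c) = [])"

lemma halts_Nil [simp]: "halts ([], s)"
  unfolding halts_def by (rule exI[of _ 0]) simp

lemma halts_step: "halts (step c) \<longleftrightarrow> halts c"
proof
  assume "halts (step c)"
  then obtain T where "fst ((step ^^ T) (step c)) = []" by (auto simp: halts_def)
  then show "halts c" unfolding halts_def by (intro exI[of _ "Suc T"]) (simp add: funpow_swap1)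
next
  assume "halts c"
  then obtain T where T: "fst ((step ^^ T) c) = []" by (auto simp: halts_def)
  \<comment> \<open>Finished configurations are fixed points of \<open>step\<close>, so one more
    step does no harm.\<close>
  obtain s where "(step ^^ T) c = ([], s)" using T by (metis prod.collapse)
  then have "fst ((step ^^ T) (step c)) = []" by (simp add: funpow_swap1[symmetric])
  then show "halts (step c)" by (auto simp: halts_def)
qed

lemma halts_Upd [simp]:
  "halts (Upd r a r' i # k, s) \<longleftrightarrow> halts (k, s(r := nat (a * int (s r') + i)))"
  using halts_step[of "(Upd r a r' i # k, s)"] by simp

lemma halts_While:
  "halts (While r b # k, s) \<longleftrightarrow> halts (if s r = 0 then k else b @ While r b # k, s)"
  using halts_step[of "(While r b # k, s)"] by simp

lemma not_halts_loop:
  assumes "s r \<noteq> 0" shows "\<not> halts (While r [] # k, s)"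
proof -
  have "(step ^^ T) (While r [] # k, s) = (While r [] # k, s)" for T
    using assms by (induction T) auto
  then show ?thesis by (simp add: halts_def)
qed

text \<open>The code for an ill-formed application is arbitrary, since only terminating evaluations are
  simulated. In the loop for \<open>PrimRec\<close>, the registers \<open>d\<close>, \<open>d + 1\<close> and \<open>d + 2\<close> hold the current
  value, the number of iterations done and the number of iterations left.\<close>

fun compile :: "recf \<Rightarrow> nat list \<Rightarrow> nat \<Rightarrow> com list"
  and compile_list :: "recf list \<Rightarrow> nat list \<Rightarrow> nat \<Rightarrow> com list" where
  "compile Zero as d = [Upd d 0 d 0]"
| "compile Succ as d = [Upd d 1 (hd as) 1]"
| "compile (Proj i) as d = [Upd d 1 (as ! i) 0]"
| "compile (Comp f gs) as d =
     compile_list gs as d @ compile f [d..<d + length gs] (d + length gs) @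
     [Upd d 1 (d + length gs) 0]"
| "compile (PrimRec f g) as d =
     compile f (tl as) d @ [Upd (d + 1) 0 d 0, Upd (d + 2) 1 (hd as) 0,
       While (d + 2)
         (Upd (d + 2) 1 (d + 2) (- 1) # compile g ((d + 1) # d # tl as) (d + 3) @
           [Upd d 1 (d + 3) 0, Upd (d + 1) 1 (d + 1) 1])]"
| "compile (Mu f) as d =
     Upd d 0 d 0 # compile f (d # as) (d + 1) @
       [While (d + 1) (Upd d 1 d 1 # compile f (d # as) (d + 1))]"
| "compile_list [] as d = []"
| "compile_list (g # gs) as d = compile g as d @ compile_list gs as (d + 1)"

text \<open>Halting equivalence under every continuation takes the place of reachability: it
  composes without counting steps, and halting is all that the reduction observes.\<close>

definition leads_to :: "com list \<Rightarrow> (nat \<Rightarrow> nat) \<Rightarrow> (nat \<Rightarrow> nat) \<Rightarrow> bool" where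
  "leads_to c s s' \<longleftrightarrow> (\<forall>k. halts (c @ k, s) \<longleftrightarrow> halts (k, s'))"

text \<open>Registers above \<open>d\<close> are scratch space.\<close>

definition computes :: "com list \<Rightarrow> nat \<Rightarrow> (nat \<Rightarrow> nat) \<Rightarrow> nat \<Rightarrow> bool" where
  "computes c d s y \<longleftrightarrow> (\<exists>s'. leads_to c s s' \<and> s' d = y \<and> (\<forall>r<d. s' r = s r))"

lemma map_eq_below:
  "\<forall>r<d. s' r = s r \<Longrightarrow> set as \<subseteq> {..<d} \<Longrightarrow> map s' as = map s as" for s :: "nat \<Rightarrow> nat"
  by auto

text \<open>The first assumption will be the induction hypothesis in the case \<open>Comp\<close>.
  Result i goes to register d + i, and later calls, whose scratch space begins higher, leave it
  alone.\<close>

lemma compile_list_computes: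
  assumes "\<And>g as d s y. g \<in> set gs \<Longrightarrow> evaluates g (map s as) y \<Longrightarrow> set as \<subseteq> {..<d} \<Longrightarrow>
      computes (compile g as d) d s y"
    and "list_all2 (\<lambda>g y. evaluates g (map s as) y) gs ys" "set as \<subseteq> {..<d}"
  shows "\<exists>s'. leads_to (compile_list gs as d) s s' \<and> (\<forall>i<length gs. s' (d + i) = ys ! i) \<and>
    (\<forall>r<d. s' r = s r)"
  using assms
proof (induction gs arbitrary: ys d s)
  case Nil
  then show ?case by (auto simp: leads_to_def)
next
  case (Cons g gs)
  then obtain y ys' where ys: "ys = y # ys'" "evaluates g (map s as) y"
    "list_all2 (\<lambda>g y. evaluates g (map s as) y) gs ys'" by (auto simp: list_all2_Cons1)
  obtain s1 where s1: "leads_to (compile g as d) s s1" "s1 d = y" "\<forall>r<d. s1 r = s r"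
    using Cons.prems(1)[OF _ ys(2) Cons.prems(3)] by (auto simp: computes_def)
  have "map s1 as = map s as" using s1(3) Cons.prems(3) by (rule map_eq_below)
  then have "list_all2 (\<lambda>g y. evaluates g (map s1 as) y) gs ys'" using ys(3) by (simp only:)
  moreover have "set as \<subseteq> {..<d + 1}" using Cons.prems(3) by auto
  ultimately obtain s2 where s2: "leads_to (compile_list gs as (d + 1)) s1 s2"
      "\<forall>i<length gs. s2 (d + 1 + i) = ys' ! i" "\<forall>r<d + 1. s2 r = s1 r"
    using Cons.IH[of s1 ys' "d + 1"] Cons.prems(1) by auto
  have "s2 (d + i) = ys ! i" if "i < length (g # gs)" for i
    using that s1 s2 ys(1) by (cases i) auto
  moreover have "leads_to (compile_list (g # gs) as d) s s2"
    using s1(1) s2(1) by (simp add: leads_to_def)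
  ultimately show ?case using s1(3) s2(3) by (intro exI[of _ s2]) auto
qed

lemma evaluates_PrimRec_Suc:
  assumes "evaluates (PrimRec f g) (Suc n # xs) y"
  obtains r where "evaluates (PrimRec f g) (n # xs) r" "evaluates g (n # r # xs) y"
  using assms by (cases rule: evaluates.cases) auto

text \<open>Induction on the term, with state, arguments and scratch base general. The two kinds of
  loop are unrolled by inner inductions on their counters.\<close>

lemma compile_computes:
  "evaluates f (map s as) y \<Longrightarrow> set as \<subseteq> {..<d} \<Longrightarrow> computes (compile f as d) d s y"
proof (induction f arbitrary: as d s y)
  case Zero
  then have "y = 0" by (auto elim: evaluates.cases)
  then show ?case
    by (auto simp: computes_def leads_to_def intro!: exI[of _ "s(d := 0)"])
next
  case Succ
  then obtain a where "as = [a]" "y = Suc (s a)" by (auto elim: evaluates.cases)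
  then show ?case
    by (auto simp: computes_def leads_to_def nat_add_distrib intro!: exI[of _ "s(d := y)"])
next
  case (Proj i)
  then have "i < length as" "y = s (as ! i)" by (auto elim: evaluates.cases)
  then show ?case
    by (auto simp: computes_def leads_to_def intro!: exI[of _ "s(d := y)"])
next
  case (Comp f gs)
  from Comp.prems(1) obtain ys where ys: "list_all2 (\<lambda>g y. evaluates g (map s as) y) gs ys"
      "evaluates f ys y" by (auto elim: evaluates.cases)
  define m where "m = length gs"
  obtain s1 where s1: "leads_to (compile_list gs as d) s s1" "\<forall>i<m. s1 (d + i) = ys ! i"
      "\<forall>r<d. s1 r = s r"
    using compile_list_computes[OF Comp.IH(2) ys(1) Comp.prems(2)] by (auto simp: m_def)
  have "length ys = m" using ys(1) by (simp add: m_def list_all2_lengthD)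
  then have "map s1 [d..<d + m] = ys" using s1(2) by (intro nth_equalityI) auto
  moreover have "set [d..<d + m] \<subseteq> {..<d + m}" by auto
  ultimately obtain s2 where s2: "leads_to (compile f [d..<d + m] (d + m)) s1 s2" "s2 (d + m) = y"
      "\<forall>r<d + m. s2 r = s1 r"
    using Comp.IH(1)[of s1 "[d..<d + m]" y "d + m"] ys(2) unfolding computes_def by metis
  show ?case unfolding computes_def
    using s1 s2 by (intro exI[of _ "s2(d := y)"]) (auto simp: leads_to_def m_def)
next
  case (PrimRec f g)
  from PrimRec.prems(1) obtain a as' where as: "as = a # as'" by (auto elim: evaluates.cases)
  have as': "set as' \<subseteq> {..<d}" "a < d" using PrimRec.prems(2) as by auto
  define xs where "xs = map s as'"
  define body where "body = Upd (d + 2) 1 (d + 2) (- 1) # compile g ((d + 1) # d # as') (d + 3) @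
           [Upd d 1 (d + 3) 0, Upd (d + 1) 1 (d + 1) 1]"
  \<comment> \<open>Invariant after n iterations with m left. The start state \<open>s0\<close>
    stays fixed: the induction step uses the hypothesis for n with \<open>Suc m\<close> iterations
    left and then runs the body once.\<close>
  have loop: "\<exists>s'. (\<forall>k. halts (While (d + 2) body # k, s0) \<longleftrightarrow> halts (While (d + 2) body # k, s')) \<and>
      s' d = r \<and> s' (d + 1) = n \<and> s' (d + 2) = m \<and> (\<forall>r<d. s' r = s r)"
    if "evaluates (PrimRec f g) (n # xs) r" "evaluates f xs (s0 d)"
      "s0 (d + 1) = 0" "s0 (d + 2) = n + m" "\<forall>r<d. s0 r = s r" for n m r s0
    using that
  proof (induction n arbitrary: m r)
    case 0
    then have "evaluates f xs r" by (auto elim: evaluates.cases)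
    then have "r = s0 d" using 0 evaluates_deterministic by blast
    then show ?case using 0 by (intro exI[of _ s0]) simp
  next
    case (Suc n)
    obtain r' where r': "evaluates (PrimRec f g) (n # xs) r'" "evaluates g (n # r' # xs) r"
      using Suc.prems(1) by (rule evaluates_PrimRec_Suc)
    obtain s1 where s1: "\<And>k. halts (While (d + 2) body # k, s0) \<longleftrightarrow> halts (While (d + 2) body # k, s1)"
        "s1 d = r'" "s1 (d + 1) = n" "s1 (d + 2) = Suc m" "\<forall>r<d. s1 r = s r"
      using Suc.IH[OF r'(1), of "Suc m"] Suc.prems by auto
    define s2 where "s2 = s1(d + 2 := m)"
    have "map s2 ((d + 1) # d # as') = n # r' # xs"
      using s1 as' by (auto simp: s2_def xs_def)
    moreover have "set ((d + 1) # d # as') \<subseteq> {..<d + 3}" using as' by auto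
    ultimately obtain s3 where s3: "leads_to (compile g ((d + 1) # d # as') (d + 3)) s2 s3"
        "s3 (d + 3) = r" "\<forall>r<d + 3. s3 r = s2 r"
      using PrimRec.IH(2)[of s2 "(d + 1) # d # as'" r "d + 3"] r'(2) by (auto simp: computes_def)
    have s3': "s3 (d + 1) = n" "s3 (d + 2) = m" "\<forall>r<d. s3 r = s r"
      using s3(3) s1 by (auto simp: s2_def)
    define W where "W = While (d + 2) body"
    define s4 where "s4 = s3(d := r, d + 1 := Suc n)"
    have "halts (W # k, s1) \<longleftrightarrow> halts (W # k, s4)" for k
    proof -
      have "halts (W # k, s1) \<longleftrightarrow> halts (body @ W # k, s1)"
        using s1(4) by (simp add: W_def halts_While del: add_2_eq_Suc' add_2_eq_Suc)
      also have "\<dots> \<longleftrightarrow> halts (compile g ((d + 1) # d # as') (d + 3) @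
          [Upd d 1 (d + 3) 0, Upd (d + 1) 1 (d + 1) 1] @ W # k, s2)"
        using s1(4) by (simp add: body_def s2_def)
      also have "\<dots> \<longleftrightarrow> halts ([Upd d 1 (d + 3) 0, Upd (d + 1) 1 (d + 1) 1] @ W # k, s3)"
        using s3(1) by (simp only: leads_to_def)
      also have "\<dots> \<longleftrightarrow> halts (W # k, s4)"
      proof -
        have "s3(d := nat (1 * int (s3 (d + 3)) + 0),
            d + 1 := nat (1 * int ((s3(d := nat (1 * int (s3 (d + 3)) + 0))) (d + 1)) + 1)) = s4"
          using s3(2) s3'(1) by (simp add: s4_def nat_add_distrib)
        then show ?thesis by (simp only: append.simps halts_Upd)
      qed
      finally show ?thesis .
    qed
    moreover have "s4 d = r" "s4 (d + 1) = Suc n" "s4 (d + 2) = m" "\<forall>r<d. s4 r = s r"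
      using s3' by (auto simp: s4_def)
    ultimately show ?case using s1(1) by (intro exI[of _ s4]) (simp add: W_def)
  qed
  obtain n where n: "n = s a" by simp
  have y: "evaluates (PrimRec f g) (n # xs) y" using PrimRec.prems(1) by (simp add: as n xs_def)
  \<comment> \<open>A value of the recursion at n presupposes one at 0.\<close>
  have "\<exists>r. evaluates f xs r"
    using y by (induction n arbitrary: y) (auto elim: evaluates.cases evaluates_PrimRec_Suc)
  then obtain r where r: "evaluates f xs r" by blast
  then obtain s1 where s1: "leads_to (compile f as' d) s s1" "s1 d = r" "\<forall>r<d. s1 r = s r"
    using PrimRec.IH(1)[OF _ as'(1)] by (auto simp: computes_def xs_def)
  define s2 where "s2 = s1(d + 1 := 0, d + 2 := n)"
  obtain s3 where s3: "\<And>k. halts (While (d + 2) body # k, s2) \<longleftrightarrow> halts (While (d + 2) body # k, s3)"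
      "s3 d = y" "s3 (d + 2) = 0" "\<forall>r<d. s3 r = s r"
    using loop[OF y, of s2 0] r s1 by (auto simp: s2_def)
  have "\<And>k. halts (While (d + 2) body # k, s2) \<longleftrightarrow> halts (k, s3)"
    using s3(1,3) by (simp add: halts_While[of _ _ _ s3])
  then have "leads_to (compile (PrimRec f g) as d) s s3"
    using s1 as'(2) by (simp add: leads_to_def as body_def s2_def n)
  then show ?case using s3 by (auto simp: computes_def)
next
  case (Mu f)
  let ?xs = "map s as"
  define body where "body = Upd d 1 d 1 # compile f (d # as) (d + 1)"
  from Mu.prems(1) have y: "evaluates f (y # ?xs) 0"
      "\<And>m. m < y \<Longrightarrow> \<exists>z. evaluates f (m # ?xs) (Suc z)" by (auto elim: evaluates.cases)
  have args: "set (d # as) \<subseteq> {..<d + 1}" using Mu.prems(2) by auto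
  have call: "\<exists>s'. leads_to (compile f (d # as) (d + 1)) s1 s' \<and> s' (d + 1) = z \<and>
      s' d = n \<and> (\<forall>r<d. s' r = s r)"
    if "evaluates f (n # ?xs) z" "s1 d = n" "\<forall>r<d. s1 r = s r" for n z s1
  proof -
    have "map s1 (d # as) = n # ?xs" using that Mu.prems(2) by auto
    then have "computes (compile f (d # as) (d + 1)) (d + 1) s1 z"
      using that(1) by (intro Mu.IH[OF _ args]) (simp only:)
    then show ?thesis using that by (auto simp: computes_def)
  qed
  \<comment> \<open>Loop invariant: register d holds the candidate n, register d + 1 the value of
    \<open>f\<close> at n. Before y this value is nonzero, so the loop goes on; at y it is
    0.\<close>
  have "\<exists>s'. (\<forall>k. halts (compile (Mu f) as d @ k, s) \<longleftrightarrow> halts (While (d + 1) body # k, s')) \<and>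
      s' d = n \<and> (\<forall>r<d. s' r = s r) \<and> evaluates f (n # ?xs) (s' (d + 1))" if "n \<le> y" for n
    using that
  proof (induction n)
    case 0
    obtain z where z: "evaluates f (0 # ?xs) z" using y by (cases y) auto
    obtain s1 where "leads_to (compile f (d # as) (d + 1)) (s(d := 0)) s1" "s1 (d + 1) = z"
        "s1 d = 0" "\<forall>r<d. s1 r = s r"
      using call[OF z, of "s(d := 0)"] by auto
    then show ?case using z
      by (intro exI[of _ s1]) (auto simp: leads_to_def body_def)
  next
    case (Suc n)
    then obtain s1 where s1: "\<And>k. halts (compile (Mu f) as d @ k, s) \<longleftrightarrow> halts (While (d + 1) body # k, s1)"
        "s1 d = n" "\<forall>r<d. s1 r = s r" "evaluates f (n # ?xs) (s1 (d + 1))" by auto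
    have nz: "s1 (d + 1) \<noteq> 0"
      using y(2)[of n] Suc.prems s1(4) by (metis Suc_le_lessD evaluates_deterministic nat.distinct(1))
    obtain z where z: "evaluates f (Suc n # ?xs) z"
      using y Suc.prems by (cases "Suc n = y") (auto dest: le_neq_implies_less)
    obtain s2 where "leads_to (compile f (d # as) (d + 1)) (s1(d := Suc n)) s2" "s2 (d + 1) = z"
        "s2 d = Suc n" "\<forall>r<d. s2 r = s r"
      using call[OF z, of "s1(d := Suc n)"] s1(3) by auto
    moreover have "nat (1 + int n) = Suc n" by simp
    ultimately show ?case using z s1 nz
      by (intro exI[of _ s2]) (auto simp: leads_to_def halts_While[of _ _ _ s1] body_def add.commute)
  qed
  from this[of y] obtain s1 where
    s1: "\<And>k. halts (compile (Mu f) as d @ k, s) \<longleftrightarrow> halts (While (d + 1) body # k, s1)"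
      "s1 d = y" "\<forall>r<d. s1 r = s r" "evaluates f (y # ?xs) (s1 (d + 1))" by auto
  have "s1 (d + 1) = 0" using s1(4) y(1) by (rule evaluates_deterministic)
  then have "leads_to (compile (Mu f) as d) s s1"
    using s1(1) by (simp add: leads_to_def halts_While del: compile.simps)
  then show ?case using s1 by (auto simp: computes_def)
qed

subsection \<open>Computing the code of an instance\<close>

definition computable :: "(nat \<Rightarrow> nat) \<Rightarrow> bool" where
  "computable g \<longleftrightarrow> (\<exists>e. \<forall>x. evaluates e [x] (g x))"

lemma computable_id: "computable (\<lambda>x. x)"
  unfolding computable_def using evaluates.proj[of 0] by (intro exI[of _ "Proj 0"]) fastforce

lemma computable_comp:
  assumes "computable g" "\<And>y. evaluates e [y] (h y)" shows "computable (\<lambda>x. h (g x))"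
proof -
  obtain d where "\<And>x. evaluates d [x] (g x)" using assms(1) by (auto simp: computable_def)
  then have "evaluates (Comp e [d]) [x] (h (g x))" for x
    using assms(2) by (intro evaluates.comp[where ys = "[g x]"]) auto
  then show ?thesis unfolding computable_def by blast
qed

lemma computable_comp2:
  assumes "computable f" "computable g" "\<And>y z. evaluates e [y, z] (h y z)"
  shows "computable (\<lambda>x. h (f x) (g x))"
proof -
  obtain c d where "\<And>x. evaluates c [x] (f x)" "\<And>x. evaluates d [x] (g x)"
    using assms(1,2) by (auto simp: computable_def)
  then have "evaluates (Comp e [c, d]) [x] (h (f x) (g x))" for x
    using assms(3) by (intro evaluates.comp[where ys = "[f x, g x]"]) auto
  then show ?thesis unfolding computable_def by blast
qed

lemma computable_Suc: "computable g \<Longrightarrow> computable (\<lambda>x. Suc (g x))"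
  using computable_comp[OF _ evaluates.succ] by simp

lemma computable_const: "computable (\<lambda>_. n)"
proof (induction n)
  case 0
  show ?case unfolding computable_def using evaluates.zero by blast
qed (rule computable_Suc)

lemma evaluates_Proj: "i < length xs \<Longrightarrow> y = xs ! i \<Longrightarrow> evaluates (Proj i) xs y"
  by (simp add: evaluates.proj)

definition add_recf :: recf where "add_recf = PrimRec (Proj 0) (Comp Succ [Proj 1])"

lemma evaluates_add: "evaluates add_recf [m, n] (m + n)"
  unfolding add_recf_def
proof (induction m)
  case 0
  show ?case by (intro evaluates.rec_0 evaluates_Proj) auto
next
  case (Suc m)
  have "evaluates (Comp Succ [Proj 1]) [m, m + n, n] (Suc m + n)"
    using evaluates.succ[of "m + n"]
    by (intro evaluates.comp[where ys = "[m + n]"]) (auto intro: evaluates_Proj)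
  with Suc show ?case by (rule evaluates.rec_Suc)
qed

text \<open>Pairing m with n by \<open>prod_encode\<close> gives the triangle number of m + n, plus
  m. So addition and triangle numbers suffice to compute it.\<close>

definition triangle_recf :: recf where
  "triangle_recf = PrimRec Zero (Comp add_recf [Proj 1, Comp Succ [Proj 0]])"

lemma evaluates_triangle: "evaluates triangle_recf [n] (triangle n)"
  unfolding triangle_recf_def
proof (induction n)
  case 0
  show ?case using evaluates.zero by (simp add: evaluates.rec_0)
next
  case (Suc n)
  have "evaluates (Comp Succ [Proj 0]) [n, triangle n] (Suc n)"
    using evaluates.succ[of n]
    by (intro evaluates.comp[where ys = "[n]"]) (auto intro: evaluates_Proj)
  then have "evaluates (Comp add_recf [Proj 1, Comp Succ [Proj 0]]) [n, triangle n] (triangle (Suc n))"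
    using evaluates_add[of "triangle n" "Suc n"]
    by (intro evaluates.comp[where ys = "[triangle n, Suc n]"]) (auto intro: evaluates_Proj)
  with Suc show ?case by (rule evaluates.rec_Suc)
qed

lemma computable_add: "computable f \<Longrightarrow> computable g \<Longrightarrow> computable (\<lambda>x. f x + g x)"
  by (rule computable_comp2[OF _ _ evaluates_add])

lemma computable_prod_encode:
  assumes "computable f" "computable g" shows "computable (\<lambda>x. prod_encode (f x, g x))"
proof -
  have "computable (\<lambda>x. triangle (f x + g x) + f x)"
    using assms by (intro computable_add computable_comp[OF _ evaluates_triangle])
  then show ?thesis by (simp add: prod_encode_def)
qed

text \<open>\<open>int_encode\<close> doubles nonnegative integers. Written as a sum, the double
  needs addition only.\<close>

lemma rat_code_of_nat: "rat_code (of_nat n) = prod_encode (n + n, 1)"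
proof -
  have "quotient_of (of_nat n) = (int n, 1)" using quotient_of_int[of "int n"] by simp
  then show ?thesis by (simp add: rat_code_def int_encode_def sum_encode_def)
qed

text \<open>The biases hold the program input, so that the code of an instance is computable from the
  codes of its other parts and the input.\<close>

definition input_layer :: "nat \<Rightarrow> layer" where
  "input_layer n =
     (mat 4 3 (\<lambda>(i, j). if i = Suc j then 1 else 0), vec_of_list [of_nat n, 0, 0, 0])"

text \<open>The ones below the diagonal shift the coordinates by one place and leave the first place
  to the bias.\<close>

lemma layer_eval_input_layer:
  assumes "x \<in> carrier_vec 3"
  shows "layer_eval (input_layer n) x = vec_of_list [real n, relu (x $ 0), relu (x $ 1), relu (x $ 2)]"
  (is "?l = ?r")
proof (rule eq_vecI)
  fix i assume "i < dim_vec ?r"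
  then have "i \<in> {0, 1, 2, 3}" by auto
  then show "?l $ i = ?r $ i"
    using assms by (auto simp: layer_eval_def input_layer_def scalar_prod_def relu_def numeral_3_eq_3
        numeral_2_eq_2)
qed (simp add: layer_eval_def input_layer_def)

lemma computable_layer_code_input_layer: "computable (\<lambda>n. layer_code (input_layer n))"
proof -
  \<comment> \<open>The matrix is the same for all n, so its code is a constant, taken from
    \<open>input_layer 0\<close>. Only the first bias varies.\<close>
  have "layer_code (input_layer n) = prod_encode
      (list_encode (map (\<lambda>row. list_encode (map rat_code row)) (mat_to_list (fst (input_layer 0)))),
       Suc (prod_encode (prod_encode (n + n, 1), list_encode (map rat_code [0, 0, 0]))))" for n
    unfolding layer_code_def by (simp only: input_layer_def fst_conv snd_conv list_vec list.map
        rat_code_of_nat list_encode.simps)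
  then show ?thesis
    by (simp only: computable_prod_encode computable_Suc computable_add computable_const computable_id)
qed

text \<open>This is the self-application: p is both the code of the message-passing part and the
  bias in the readout.\<close>

lemma computable_code:
  "computable (\<lambda>p. prod_encode (prod_encode (p, nn_code (input_layer p # R)), k))"
  unfolding nn_code_def list.map list_encode.simps
  by (intro computable_prod_encode computable_Suc computable_const computable_id
      computable_layer_code_input_layer)

subsection \<open>Runs as labelled graphs\<close>

text \<open>A finite superset of the command lists that a run can reach, whatever the registers
  contain.\<close>

fun conts :: "com list \<Rightarrow> com list set" where
  "conts [] = {[]}"
| "conts (Upd r a r' i # k) = insert (Upd r a r' i # k) (conts k)"
| "conts (While r b # k) =
     insert (While r b # k) ((\<lambda>k'. k' @ While r b # k) ` conts b \<union> conts k)"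

fun regs :: "com list \<Rightarrow> nat set" where
  "regs [] = {}"
| "regs (Upd r a r' i # k) = {r, r'} \<union> regs k"
| "regs (While r b # k) = insert r (regs b \<union> regs k)"

lemma finite_conts: "finite (conts k)" and finite_regs: "finite (regs k)"
  by (induction k rule: conts.induct) auto

lemma conts_refl: "k \<in> conts k"
  by (cases k rule: conts.cases) auto

lemma regs_append [simp]: "regs (k @ k') = regs k \<union> regs k'"
  by (induction k rule: regs.induct) auto

lemma regs_conts: "k' \<in> conts k \<Longrightarrow> regs k' \<subseteq> regs k"
  by (induction k arbitrary: k' rule: conts.induct) fastforce+

lemma conts_step: "k' \<in> conts k \<Longrightarrow> fst (step (k', s)) \<in> conts k"
proof (induction k arbitrary: k' rule: conts.induct)
  case (2 r a r' i k)
  then show ?case using conts_refl[of k] by auto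
next
  case (3 r b k)
  let ?W = "While r b # k"
  from "3.prems" consider "k' = ?W" | "k' \<in> conts k" | k'' where "k' = k'' @ ?W" "k'' \<in> conts b"
    by auto
  then show ?case
  proof cases
    case 1
    then show ?thesis using conts_refl[of k] conts_refl[of b] by auto
  next
    case 2
    then show ?thesis using "3.IH"(2) by auto
  next
    \<comment> \<open>The loop body is a prefix. Unless it is exhausted, a step acts on it alone and
      the induction hypothesis for the body applies; otherwise the loop itself is next.\<close>
    case (3 k'')
    show ?thesis
    proof (cases "k'' = []")
      case True
      then show ?thesis using 3 conts_refl[of k] conts_refl[of b] by auto
    next
      case False
      then have "fst (step (k'' @ ?W, s)) = fst (step (k'', s)) @ ?W"
        by (cases k'' rule: conts.cases) auto
      then show ?thesis using 3 "3.IH"(1) by auto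
    qed
  qed
qed simp

lemma relu_update: "relu (of_int a * real m + of_int i) = real (nat (a * int m + i))"
proof -
  have "of_int a * real m + of_int i = real_of_int (a * int m + i)" by simp
  moreover have "relu (of_int z) = real (nat z)" for z by (simp add: relu_def max_def)
  ultimately show ?thesis by metis
qed

text \<open>A node has one of three colours and stores a configuration in the block of its colour. The
  colour after its own marks the successor among its neighbours, and the time stamp prevents
  infinite runs from being folded into a cycle.\<close>

locale machine =
  fixes P :: "com list" and R :: nat and idx :: "com list \<Rightarrow> nat"
  assumes regs_bound: "regs P \<subseteq> {..<R}" and R_pos: "0 < R" and inj_idx: "inj_on idx (conts P)"
begin

text \<open>A block consists of colour flag, time stamp, index of the command list and R registers.
  Three blocks are followed by the root flag and the program input.\<close>

definition width :: nat where "width = 3 + R"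
definition dim :: nat where "dim = 3 * width + 2"
definition pos :: "nat \<Rightarrow> nat \<Rightarrow> nat" where "pos c j = c * width + j"
definition root :: nat where "root = 3 * width"
definition arg :: nat where "arg = 3 * width + 1"
definition next_col :: "nat \<Rightarrow> nat" where "next_col c = Suc c mod 3"

fun entry :: "nat \<Rightarrow> config \<Rightarrow> nat \<Rightarrow> real" where
  "entry t (k, s) j =
     (if j = 0 then 1 else if j = 1 then real t else if j = 2 then real (idx k) else real (s (j - 3)))"

text \<open>As the other two blocks vanish, a sum over neighbours keeps the colours apart: each
  block of the sum collects the neighbours of its own colour only.\<close>

definition coloured :: "(nat \<Rightarrow> real) \<Rightarrow> nat \<Rightarrow> bool" where
  "coloured x c \<longleftrightarrow> x (pos c 0) = 1 \<and> (\<forall>c' \<in> {..<3} - {c}. \<forall>j \<in> {..<width}. x (pos c' j) = 0)"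

text \<open>Here x is the label of the node and y the sum over its neighbours. A nonzero register is
  tested by \<open>1 \<le>\<close>, since strict conditions are not zero sets; for natural numbers
  this is the same.\<close>

definition successor_ok :: "nat \<Rightarrow> com list \<Rightarrow> (nat \<Rightarrow> real) \<Rightarrow> (nat \<Rightarrow> real) \<Rightarrow> bool" where
  "successor_ok c k x y \<longleftrightarrow> k = [] \<or>
     y (pos (next_col c) 0) = 1 \<and> y (pos (next_col c) 1) = x (pos c 1) + 1 \<and>
     (case hd k of
        Upd r a r' i \<Rightarrow> y (pos (next_col c) 2) = of_nat (idx (tl k)) \<and>
          (\<forall>j \<in> {..<R}. y (pos (next_col c) (3 + j)) =
            (if j = r then relu (of_int a * x (pos c (3 + r')) + of_int i) else x (pos c (3 + j))))
      | While r b \<Rightarrow>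
          (x (pos c (3 + r)) = 0 \<and> y (pos (next_col c) 2) = of_nat (idx (tl k)) \<or>
           1 \<le> x (pos c (3 + r)) \<and> y (pos (next_col c) 2) = of_nat (idx (b @ k))) \<and>
          (\<forall>j \<in> {..<R}. y (pos (next_col c) (3 + j)) = x (pos c (3 + j))))"

text \<open>Every node stores register 0, so the root repeats it in a coordinate that is 0
  elsewhere; the sum of that coordinate over all nodes is then the input. The sign condition
  protects it from the ReLU at the end of the layer.\<close>

definition root_ok :: "nat \<Rightarrow> (nat \<Rightarrow> real) \<Rightarrow> bool" where
  "root_ok c x \<longleftrightarrow> x root = 0 \<and> x arg = 0 \<or>
     x root = 1 \<and> 0 \<le> x arg \<and> x arg = x (pos c 3) \<and> x (pos c 2) = of_nat (idx P) \<and>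
     (\<forall>j \<in> {1..<R}. x (pos c (3 + j)) = 0)"

definition node_ok :: "(nat \<Rightarrow> real) \<Rightarrow> (nat \<Rightarrow> real) \<Rightarrow> bool" where
  "node_ok x y \<longleftrightarrow> (\<exists>c \<in> {..<3}. coloured x c \<and> root_ok c x \<and>
     (\<exists>k \<in> conts P. x (pos c 2) = of_nat (idx k) \<and> successor_ok c k x y))"

definition coords :: "'v graph \<Rightarrow> 'v \<Rightarrow> nat \<Rightarrow> real" where
  "coords G v i = (if i < dim then label G v $ i else 0)"

definition neigh_sum :: "'v graph \<Rightarrow> 'v \<Rightarrow> nat \<Rightarrow> real" where
  "neigh_sum G v i = (\<Sum>w \<in> neigh G v. coords G w i)"

definition encodes_input :: "'v graph \<Rightarrow> nat \<Rightarrow> bool" where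
  "encodes_input G n \<longleftrightarrow> (\<forall>v \<in> nodes G. node_ok (coords G v) (neigh_sum G v)) \<and>
     (\<Sum>v \<in> nodes G. coords G v root) = 1 \<and> (\<Sum>v \<in> nodes G. coords G v arg) = real n"

text \<open>No absolute time is recorded: stamps may be arbitrary reals, and only their increase by
  1 from node to successor matters.\<close>

definition represents :: "(nat \<Rightarrow> real) \<Rightarrow> nat \<Rightarrow> config \<Rightarrow> bool" where
  "represents x c cf \<longleftrightarrow> coloured x c \<and> fst cf \<in> conts P \<and> x (pos c 2) = real (idx (fst cf)) \<and>
     (\<forall>j<R. x (pos c (3 + j)) = real (snd cf j))"

section \<open>From an accepted graph to a halting run\<close>

lemma coloured_unique:
  assumes "coloured x c" "coloured x c'" "c < 3" "c' < 3" shows "c = c'"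
proof (rule ccontr)
  assume "c \<noteq> c'"
  then have "x (pos c 0) = 0" using assms by (auto simp: coloured_def width_def)
  then show False using assms by (simp add: coloured_def)
qed

lemma next_col_less: "next_col c < 3" by (simp add: next_col_def)

text \<open>In block c of the sum, neighbours of other colours contribute 0 and each neighbour of
  colour c has flag 1. Flag sum 1 thus means exactly one such neighbour, and the block of the sum is
  its block.\<close>

lemma unique_neighbour:
  assumes G: "labelled_graph dim G" and ok: "\<forall>v \<in> nodes G. node_ok (coords G v) (neigh_sum G v)"
    and c: "c < 3" "neigh_sum G v (pos c 0) = 1"
  obtains w where "w \<in> nodes G" "coloured (coords G w) c"
    "\<And>j. j < width \<Longrightarrow> neigh_sum G v (pos c j) = coords G w (pos c j)"
proof -
  have sub: "neigh G v \<subseteq> nodes G" and fin: "finite (nodes G)"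
    using G by (auto simp: labelled_graph_def neigh_def)
  have fin': "finite (neigh G v)" using sub fin by (rule finite_subset)
  let ?S = "{w \<in> neigh G v. coloured (coords G w) c}"
  have zero: "coords G w (pos c j) = 0"
    if w: "w \<in> neigh G v" "w \<notin> ?S" and j: "j < width" for w j
  proof -
    have "node_ok (coords G w) (neigh_sum G w)" using ok w(1) sub by blast
    then obtain c' where c': "c' < 3" "coloured (coords G w) c'" by (auto simp: node_ok_def)
    then have "c' \<noteq> c" using w by auto
    then show ?thesis using c'(2) c j by (auto simp: coloured_def)
  qed
  have sum: "neigh_sum G v (pos c j) = (\<Sum>w \<in> ?S. coords G w (pos c j))" if "j < width" for j
    unfolding neigh_sum_def using fin' zero that by (intro sum.mono_neutral_right) auto
  have "(\<Sum>w \<in> ?S. coords G w (pos c 0)) = (\<Sum>w \<in> ?S. 1)"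
    by (rule sum.cong) (auto simp: coloured_def)
  then have "neigh_sum G v (pos c 0) = (\<Sum>w \<in> ?S. 1)"
    using sum[of 0] by (simp add: width_def)
  then have "card ?S = 1" using c by simp
  then obtain w where w: "?S = {w}" by (rule card_1_singletonE)
  then have "w \<in> ?S" by simp
  then have "w \<in> nodes G" "coloured (coords G w) c" using sub by auto
  then show ?thesis using sum by (intro that[of w]) (auto simp: w)
qed

lemma represents_step:
  assumes G: "labelled_graph dim G" and ok: "\<forall>v \<in> nodes G. node_ok (coords G v) (neigh_sum G v)"
    and v: "v \<in> nodes G" "c < 3" "represents (coords G v) c (k, s)" "k \<noteq> []"
  obtains w where "w \<in> nodes G" "represents (coords G w) (next_col c) (step (k, s))"
    "coords G w (pos (next_col c) 1) = coords G v (pos c 1) + 1"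
proof -
  let ?x = "coords G v" and ?y = "neigh_sum G v"
  have rep: "coloured ?x c" "k \<in> conts P" "?x (pos c 2) = real (idx k)"
      "\<And>j. j < R \<Longrightarrow> ?x (pos c (3 + j)) = real (s j)"
    using v(3) by (auto simp: represents_def)
  from ok v(1) obtain c' k' where c': "c' < 3" "coloured ?x c'" "k' \<in> conts P"
      "?x (pos c' 2) = of_nat (idx k')" "successor_ok c' k' ?x ?y"
    by (auto simp: node_ok_def)
  \<comment> \<open>\<open>node_ok\<close> only promises some colour and some command list. The
    colour is unique, and the index determines the command list.\<close>
  have "c' = c" using coloured_unique[OF c'(2) rep(1) c'(1) v(2)] .
  moreover have "k' = k" using c'(3,4) rep(2,3) inj_idx \<open>c' = c\<close> by (auto simp: inj_on_def)
  ultimately have succ: "successor_ok c k ?x ?y" using c' by simp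
  have y: "?y (pos (next_col c) 0) = 1" "?y (pos (next_col c) 1) = ?x (pos c 1) + 1"
    using succ v(4) by (auto simp: successor_ok_def)
  obtain w where w: "w \<in> nodes G" "coloured (coords G w) (next_col c)"
      "\<And>j. j < width \<Longrightarrow> ?y (pos (next_col c) j) = coords G w (pos (next_col c) j)"
    using unique_neighbour[OF G ok next_col_less y(1)] by metis
  have regs: "regs k \<subseteq> {..<R}" using regs_conts[OF rep(2)] regs_bound by blast
  have "?y (pos (next_col c) 2) = real (idx (fst (step (k, s)))) \<and>
      (\<forall>j<R. ?y (pos (next_col c) (3 + j)) = real (snd (step (k, s)) j))"
  proof (cases k rule: conts.cases)
    case (2 r a r' i k')
    then show ?thesis using succ regs rep(4) by (auto simp: successor_ok_def relu_update)
  next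
    case (3 r b k')
    then have "?x (pos c (3 + r)) = real (s r)" using rep(4) regs by auto
    then show ?thesis using succ rep(4) by (auto simp: successor_ok_def 3)
  qed (use v(4) in simp)
  then have "represents (coords G w) (next_col c) (step (k, s))"
    using w conts_step[OF rep(2)] by (auto simp: represents_def width_def)
  moreover have "coords G w (pos (next_col c) 1) = ?x (pos c 1) + 1"
    using y(2) w(3)[of 1] by (simp add: width_def)
  ultimately show ?thesis using that w(1) by blast
qed

text \<open>Stamps grow along successors, so the number of nodes with a later stamp decreases. In a
  finite graph the run must therefore end.\<close>

lemma represents_halts:
  assumes G: "labelled_graph dim G" and ok: "\<forall>v \<in> nodes G. node_ok (coords G v) (neigh_sum G v)"
    and "v \<in> nodes G" "c < 3" "represents (coords G v) c cf"
  shows "halts cf"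
proof -
  define later where "later y = {w \<in> nodes G. \<exists>c<3. coloured (coords G w) c \<and>
    y < coords G w (pos c 1)}" for y
  have fin: "finite (later y)" for y using G by (simp add: later_def labelled_graph_def)
  show ?thesis
    using assms(3-)
  proof (induction "card (later (coords G v (pos c 1)))" arbitrary: v c cf rule: less_induct)
    case less
    obtain k s where cf: "cf = (k, s)" by (cases cf)
    show ?case
    proof (cases "k = []")
      case False
      obtain w where w: "w \<in> nodes G" "represents (coords G w) (next_col c) (step (k, s))"
          "coords G w (pos (next_col c) 1) = coords G v (pos c 1) + 1"
        using represents_step[OF G ok less.prems(1,2) less.prems(3)[unfolded cf] False] by metis
      have col: "coloured (coords G w) (next_col c)" using w(2) by (simp add: represents_def)
      have "w \<in> later (coords G v (pos c 1))"
        using w(1,3) col next_col_less unfolding later_def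
        by (intro CollectI conjI exI[of _ "next_col c"]) auto
      \<comment> \<open>\<open>later\<close> leaves the colour open. Uniqueness of the colour of
        \<open>w\<close> is what rules out that \<open>w\<close> is later than itself.\<close>
      moreover have "w \<notin> later (coords G w (pos (next_col c) 1))"
        using coloured_unique[OF col _ next_col_less] by (auto simp: later_def)
      moreover have "later (coords G w (pos (next_col c) 1)) \<subseteq> later (coords G v (pos c 1))"
        using w(3) by (auto simp: later_def)
      ultimately have "later (coords G w (pos (next_col c) 1)) \<subset> later (coords G v (pos c 1))"
        by blast
      then have "card (later (coords G w (pos (next_col c) 1))) < card (later (coords G v (pos c 1)))"
        using fin by (intro psubset_card_mono)
      then show ?thesis
        using less.hyps[OF _ w(1) next_col_less w(2)] by (simp add: cf halts_step)
    qed (simp add: cf)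
  qed
qed

text \<open>Root flags are 0 or 1 and add up to 1, so there is a single root. It carries the whole
  sum n of the inputs and stores the initial configuration.\<close>

lemma encodes_input_halts:
  assumes G: "labelled_graph dim G" and enc: "encodes_input G n"
  shows "halts (P, (\<lambda>_. 0)(0 := n))"
proof -
  have ok: "\<forall>v \<in> nodes G. node_ok (coords G v) (neigh_sum G v)"
    and cnt: "(\<Sum>v \<in> nodes G. coords G v root) = 1"
    and input: "(\<Sum>v \<in> nodes G. coords G v arg) = real n"
    using enc by (auto simp: encodes_input_def)
  have fin: "finite (nodes G)" using G by (simp add: labelled_graph_def)
  let ?S = "{v \<in> nodes G. coords G v root = 1}"
  have other: "coords G v root = 0 \<and> coords G v arg = 0" if "v \<in> nodes G - ?S" for v
  proof -
    have "node_ok (coords G v) (neigh_sum G v)" using ok that by blast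
    then show ?thesis using that by (auto simp: node_ok_def root_ok_def)
  qed
  have sum: "(\<Sum>v \<in> nodes G. coords G v i) = (\<Sum>v \<in> ?S. coords G v i)" if "i \<in> {root, arg}" for i
    using fin other that by (intro sum.mono_neutral_right) auto
  have "real (card ?S) = 1" using cnt sum[of root] by simp
  then have "card ?S = 1" by simp
  then obtain v where v: "?S = {v}" by (rule card_1_singletonE)
  then have v': "v \<in> nodes G" "coords G v root = 1" by auto
  have arg: "coords G v arg = real n" using input sum[of arg] by (simp add: v)
  from ok v' obtain c where c: "c < 3" "coloured (coords G v) c" "root_ok c (coords G v)"
    by (auto simp: node_ok_def)
  have "coords G v (pos c (3 + j)) = real (((\<lambda>_. 0)(0 := n)) j)" if "j < R" for j
    using c(3) v'(2) arg that by (cases "j = 0") (auto simp: root_ok_def)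
  then have "represents (coords G v) c (P, (\<lambda>_. 0)(0 := n))"
    using c v'(2) conts_refl by (auto simp: represents_def root_ok_def)
  then show ?thesis using represents_halts[OF G ok v'(1) c(1)] by blast
qed


section \<open>From a halting run to an accepted graph\<close>

lemma pos_less: "c < 3 \<Longrightarrow> j < width \<Longrightarrow> pos c j < 3 * width"
proof -
  assume *: "c < 3" "j < width"
  then have "c = 0 \<or> c = 1 \<or> c = 2" by auto
  then show ?thesis using * by (auto simp: pos_def)
qed

lemma index_less: "c < 3 \<Longrightarrow> j < width \<Longrightarrow> pos c j < dim" "root < dim" "arg < dim"
  using pos_less[of c j] by (simp_all add: dim_def root_def arg_def)

definition node_label :: "config \<Rightarrow> nat \<Rightarrow> nat \<Rightarrow> real vec" where
  "node_label cf n t = vec dim (\<lambda>p.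
     if p = root then (if t = 0 then 1 else 0)
     else if p = arg then (if t = 0 then real n else 0)
     else if p div width = t mod 3 then entry t cf (p mod width) else 0)"

lemma node_label_pos:
  assumes "c < 3" "j < width"
  shows "node_label cf n t $ pos c j = (if c = t mod 3 then entry t cf j else 0)"
proof -
  have "pos c j < 3 * width" using assms by (rule pos_less)
  moreover have "pos c j div width = c" "pos c j mod width = j" using assms by (auto simp: pos_def)
  ultimately show ?thesis by (auto simp: node_label_def root_def arg_def dim_def simp del: entry.simps)
qed

lemma node_label_root: "node_label cf n t $ root = (if t = 0 then 1 else 0)"
  and node_label_arg: "node_label cf n t $ arg = (if t = 0 then real n else 0)"
  by (simp_all add: node_label_def root_def arg_def dim_def)

text \<open>The graph is an undirected path on the times up to a halting time, embedded in the node
  type. A node also sees its predecessor, but three colours tell it from the successor.\<close>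

lemma halts_encodes_input:
  assumes inf: "infinite (UNIV :: 'v set)" and halts: "halts (P, (\<lambda>_. 0)(0 := n))"
  shows "\<exists>G :: 'v graph. labelled_graph dim G \<and> encodes_input G n"
proof -
  obtain h :: "nat \<Rightarrow> 'v" where h: "inj h"
    using infinite_countable_subset[OF inf] by blast
  define cf where "cf t = (step ^^ t) (P, (\<lambda>_. 0)(0 := n))" for t
  define k where "k t = fst (cf t)" for t
  define s where "s t = snd (cf t)" for t
  have cf: "cf t = (k t, s t)" for t by (simp add: k_def s_def)
  have cf_Suc: "cf (Suc t) = step (k t, s t)" for t by (simp add: cf[symmetric]) (simp add: cf_def)
  have conts: "k t \<in> conts P" for t
  proof (induction t)
    case 0
    show ?case by (simp add: k_def cf_def conts_refl)
  next
    case (Suc t)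
    then show ?case using conts_step[of "k t" P "s t"] by (simp add: k_def[of "Suc t"] cf_Suc)
  qed
  obtain T where T: "k T = []" using halts by (auto simp: halts_def k_def cf_def)
  \<comment> \<open>The label is restricted because \<open>labelled_graph\<close> demands an
    extensional function.\<close>
  define G where "G = \<lparr>nodes = h ` {..T},
    edges = {(h t, h u) |t u. t \<le> T \<and> u \<le> T \<and> (u = Suc t \<or> t = Suc u)},
    label = restrict (\<lambda>v. node_label (cf (the_inv h v)) n (the_inv h v)) (h ` {..T})\<rparr>"
  have nodes: "nodes G = h ` {..T}" by (simp add: G_def)
  have x: "coords G (h t) p = node_label (cf t) n t $ p" if "t \<le> T" "p < dim" for t p
    using that h by (simp add: coords_def G_def the_inv_f_f)
  have graph: "labelled_graph dim G"
    by (auto simp: labelled_graph_def G_def dim_def node_label_def sym_def)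
  have neigh: "neigh G (h t) = h ` {u. u \<le> T \<and> (u = Suc t \<or> t = Suc u)}" if "t \<le> T" for t
    using that h by (auto simp: neigh_def G_def inj_eq)
  have y: "neigh_sum G (h t) (pos (next_col (t mod 3)) j) = entry (Suc t) (cf (Suc t)) j"
    if "t < T" "j < width" for t j
  proof -
    let ?N = "{u. u \<le> T \<and> (u = Suc t \<or> t = Suc u)}"
    have col: "next_col (t mod 3) = Suc t mod 3" by (simp add: next_col_def mod_Suc_eq)
    have "neigh_sum G (h t) (pos (next_col (t mod 3)) j) =
        (\<Sum>u \<in> ?N. coords G (h u) (pos (next_col (t mod 3)) j))"
      using that h by (simp add: neigh_sum_def neigh sum.reindex inj_on_subset)
    also have "\<dots> = (\<Sum>u \<in> ?N. if u = Suc t then entry (Suc t) (cf (Suc t)) j else 0)"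
    proof (rule sum.cong[OF refl])
      fix u assume u: "u \<in> ?N"
      \<comment> \<open>The only other possible neighbour has time t - 1, and times that differ by 2
        have different colours modulo 3.\<close>
      have "Suc t mod 3 = u mod 3 \<longleftrightarrow> u = Suc t"
      proof
        assume "Suc t mod 3 = u mod 3"
        moreover have "Suc (Suc u) mod 3 \<noteq> u mod 3" by presburger
        ultimately show "u = Suc t" using u by auto
      qed simp
      then show "coords G (h u) (pos (next_col (t mod 3)) j) =
          (if u = Suc t then entry (Suc t) (cf (Suc t)) j else 0)"
        using u that(2) next_col_less[of "t mod 3"] by (simp add: x node_label_pos col index_less)
    qed
    also have "\<dots> = entry (Suc t) (cf (Suc t)) j"
    proof -
      have "finite ?N" by (rule finite_subset[of _ "{..T}"]) auto
      then show ?thesis using that(1) by simp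
    qed
    finally show ?thesis .
  qed
  have ok: "node_ok (coords G v) (neigh_sum G v)" if v: "v \<in> nodes G" for v
  proof -
    obtain t where t: "v = h t" "t \<le> T" using v by (auto simp: nodes)
    let ?c = "t mod 3" and ?x = "coords G v" and ?y = "neigh_sum G v"
    have own: "?x (pos ?c j) = entry t (cf t) j" if "j < width" for j
      using t that by (simp add: x node_label_pos index_less)
    have col: "coloured ?x ?c"
      using t x own index_less by (auto simp: coloured_def node_label_pos width_def cf)
    have root: "root_ok ?c ?x"
    proof (cases "t = 0")
      case True
      have "k 0 = P" "s 0 = (\<lambda>_. 0)(0 := n)" by (auto simp: k_def s_def cf_def)
      then show ?thesis
        using True own t R_pos by (auto simp: root_ok_def x index_less node_label_root node_label_arg width_def cf)
    next
      case False
      then show ?thesis using t by (simp add: root_ok_def x index_less node_label_root node_label_arg)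
    qed
    have succ: "successor_ok ?c (k t) ?x ?y"
    proof (cases "k t = []")
      case True
      then show ?thesis by (simp add: successor_ok_def)
    next
      case False
      \<comment> \<open>Only the node at time T lacks a successor, and its command list is
        empty.\<close>
      then have "t < T" using t(2) T by (metis le_neq_implies_less)
      have nb: "?y (pos (next_col ?c) j) = entry (Suc t) (step (k t, s t)) j" if "j < width" for j
        using y[OF \<open>t < T\<close> that] t(1) by (simp add: cf_Suc)
      have regs: "regs (k t) \<subseteq> {..<R}" using regs_conts[OF conts] regs_bound by blast
      show ?thesis
      proof (cases "k t" rule: conts.cases)
        case (2 r a r' i k')
        then show ?thesis using regs own nb by (auto simp: successor_ok_def relu_update cf width_def)
      next
        case (3 r b k')
        then show ?thesis using regs own nb by (auto simp: successor_ok_def cf width_def)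
      qed (use False in simp)
    qed
    have "?x (pos ?c 2) = of_nat (idx (k t))" using own[of 2] by (simp add: width_def cf)
    then show ?thesis unfolding node_ok_def using col root succ conts by force
  qed
  have "(\<Sum>v \<in> nodes G. coords G v root) = (\<Sum>t\<le>T. if t = 0 then 1 else 0)"
    using h by (simp add: nodes sum.reindex inj_on_subset x index_less node_label_root)
  moreover have "(\<Sum>v \<in> nodes G. coords G v arg) = (\<Sum>t\<le>T. if t = 0 then real n else 0)"
    using h by (simp add: nodes sum.reindex inj_on_subset x index_less node_label_arg)
  ultimately have "encodes_input G n" using ok by (simp add: encodes_input_def)
  then show ?thesis using graph by blast
qed

end

subsection \<open>Diagonalisation\<close>

text \<open>Input coordinates: program input, total violation, number of roots, total of the root
  arguments.\<close>

definition deviation :: "real vec \<Rightarrow> real" where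
  "deviation z = z $ 1 + \<bar>z $ 2 - 1\<bar> + \<bar>z $ 3 - z $ 0\<bar>"

text \<open>Fixed independently of any machine: the diagonal program must know the code of this
  network before its own message-passing layer exists.\<close>

definition readout :: nn where
  "readout = (SOME N. realizes N 4 (map (\<lambda>f u. relu (f u)) [deviation, \<lambda>_. 0]))"

lemma realizes_readout: "realizes readout 4 (map (\<lambda>f u. relu (f u)) [deviation, \<lambda>_. 0])"
proof -
  have "deviation \<in> pl 4"
    unfolding deviation_def by (intro pl.add pl_abs pl_diff pl.coord pl_1) auto
  then have "set [deviation, \<lambda>_. 0] \<subseteq> pl 4" using pl_0 by simp
  then obtain N where "realizes N 4 (map (\<lambda>f u. relu (f u)) [deviation, \<lambda>_. 0])"
    using pl_realizable[of 4 "[deviation, \<lambda>_. 0]"] by auto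
  then show ?thesis unfolding readout_def by (rule someI)
qed

section \<open>Measuring violations by one message-passing layer\<close>

context machine
begin

definition own_part :: "real vec \<Rightarrow> nat \<Rightarrow> real" where
  "own_part u i = (if i < dim then u $ i else 0)"

definition neigh_part :: "real vec \<Rightarrow> nat \<Rightarrow> real" where
  "neigh_part u i = (if i < dim then u $ (dim + i) else 0)"

lemma pl_parts: "(\<lambda>u. own_part u i) \<in> pl (2 * dim)" "(\<lambda>u. neigh_part u i) \<in> pl (2 * dim)"
  by (cases "i < dim"; simp add: own_part_def neigh_part_def pl_0 pl.coord)+

lemma pl_zero_node_ok: "pl_zero (2 * dim) (\<lambda>u. node_ok (own_part u) (neigh_part u))"
proof -
  note pl_rules = pl_parts pl_0 pl_1 pl_of_nat pl_of_int pl.add pl.relu pl_scale_int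
  note zero_rules = pl_zero_eq pl_zero_le pl_zero_conj pl_zero_disj pl_zero_const pl_zero_ball pl_zero_bex
  have "pl_zero (2 * dim) (\<lambda>u. coloured (own_part u) c)" for c
    unfolding coloured_def by (intro zero_rules pl_rules) auto
  moreover have "pl_zero (2 * dim) (\<lambda>u. root_ok c (own_part u))" for c
    unfolding root_ok_def by (intro zero_rules pl_rules) auto
  moreover have "pl_zero (2 * dim) (\<lambda>u. successor_ok c k (own_part u) (neigh_part u))" for c k
  proof (cases k rule: conts.cases)
    case (2 r a r' i k')
    \<comment> \<open>The condition compares register indices and does not depend on u, so it can be
      decided beforehand.\<close>
    have upd: "pl_zero (2 * dim) (\<lambda>u. neigh_part u p = (if b then relu (of_int a * own_part u p' + of_int i)
        else own_part u p''))" for b p p' p''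
      by (cases b) (simp_all only: if_True if_False, (intro zero_rules pl_rules)+)
    show ?thesis unfolding successor_ok_def 2 list.sel com.case
      by (intro zero_rules pl_rules upd) auto
  next
    case (3 r b k')
    show ?thesis unfolding successor_ok_def 3 list.sel com.case
      by (intro zero_rules pl_rules) auto
  qed (simp add: successor_ok_def pl_zero_const)
  ultimately show ?thesis
    unfolding node_ok_def by (intro zero_rules pl_rules finite_conts) auto
qed

text \<open>The order of quantifiers is essential: \<open>M\<close> is chosen before n, which enters
  only as a bias of the readout, so n may later be the code of \<open>M\<close>.\<close>

lemma ex_mpnn:
  "\<exists>M. \<forall>n. is_mpnn ([M], input_layer n # readout) \<and>
    mpnn_in ([M], input_layer n # readout) = dim \<and> mpnn_out ([M], input_layer n # readout) = 2 \<and>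
    (\<forall>G :: 'v graph. labelled_graph dim G \<longrightarrow>
      (mpnn_eval ([M], input_layer n # readout) G \<in> class_sem {0, 1} \<longleftrightarrow> \<not> encodes_input G n))"
proof -
  obtain viol where viol: "viol \<in> pl (2 * dim)" "\<And>u. 0 \<le> viol u"
      "\<And>u. viol u = 0 \<longleftrightarrow> node_ok (own_part u) (neigh_part u)"
    using pl_zero_node_ok by (auto simp: pl_zero_def)
  let ?fs = "[viol, \<lambda>u. own_part u root, \<lambda>u. own_part u arg]"
  obtain M where M: "realizes M (2 * dim) (map (\<lambda>f u. relu (f u)) ?fs)"
    by (rule pl_realizable[of "2 * dim" ?fs]) (use viol(1) pl_parts(1) in \<open>auto simp: dim_def\<close>)
  have M': "is_nn M" "nn_in M = 2 * dim" "nn_out M = 3"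
    and R': "is_nn readout" "nn_in readout = 4" "nn_out readout = 2" "readout \<noteq> []"
    using M realizes_readout by (auto simp: realizes_def is_nn_def)
  have R: "is_nn (input_layer n # readout)" "nn_in (input_layer n # readout) = 3" "nn_out (input_layer n # readout) = 2" for n
    using R' by (auto simp: is_nn_def nn_in_def nn_out_def input_layer_def successively_Cons)
  have eval: "mpnn_eval ([M], input_layer n # readout) G \<in> class_sem {0, 1} \<longleftrightarrow> \<not> encodes_input G n"
    if G: "labelled_graph dim G" for n and G :: "'v graph"
  proof -
    have fin: "finite (nodes G)" and carr: "\<And>v. v \<in> nodes G \<Longrightarrow> label G v \<in> carrier_vec dim"
      and sub: "\<And>v. neigh G v \<subseteq> nodes G"
      using G by (auto simp: labelled_graph_def neigh_def)
    define u where "u v = label G v @\<^sub>v finsum_vec TYPE(real) dim (label G) (neigh G v)" for v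
    have fs: "finsum_vec TYPE(real) dim (label G) (neigh G v) \<in> carrier_vec dim" for v
      using carr sub by (intro finsum_vec_closed) auto
    have u: "u v \<in> carrier_vec (2 * dim)" "own_part (u v) = coords G v" "neigh_part (u v) = neigh_sum G v"
      if "v \<in> nodes G" for v
    proof -
      show "u v \<in> carrier_vec (2 * dim)"
        using carr[OF that] fs[of v] unfolding u_def mult_2 by (rule append_carrier_vec)
      show "own_part (u v) = coords G v"
        using carr[OF that] fs[of v] by (auto simp: own_part_def coords_def u_def)
      have "finsum_vec TYPE(real) dim (label G) (neigh G v) $ i = (\<Sum>w \<in> neigh G v. label G w $ i)"
        if "i < dim" for i
        using fin sub carr that by (intro index_finsum_vec) (auto intro: finite_subset)
      then show "neigh_part (u v) = neigh_sum G v"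
        using carr[OF that] fs[of v] by (auto simp: neigh_part_def neigh_sum_def coords_def u_def)
    qed
    define m where "m = mp_step G M (label G)"
    have m: "m v = vec_of_list [viol (u v), relu (coords G v root), relu (coords G v arg)]"
      if "v \<in> nodes G" for v
    proof -
      have "m v = nn_eval M (u v)" by (simp add: m_def mp_step_def u_def M'(2))
      then show ?thesis
        using M u[OF that] viol(2)[of "u v"] by (simp add: realizes_def outputs_def)
    qed
    have m_carr: "m \<in> nodes G \<rightarrow> carrier_vec 3" using m by (auto intro!: carrier_vecI)
    let ?total = "finsum_vec TYPE(real) 3 m (nodes G)"
    define a where "a = (\<Sum>v \<in> nodes G. viol (u v))"
    define b where "b = (\<Sum>v \<in> nodes G. relu (coords G v root))"
    define d where "d = (\<Sum>v \<in> nodes G. relu (coords G v arg))"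
    have total: "?total \<in> carrier_vec 3" using m_carr by (rule finsum_vec_closed)
    have idx: "?total $ i = (\<Sum>v \<in> nodes G. m v $ i)" if "i < 3" for i
      using fin that m_carr by (rule index_finsum_vec)
    have abd: "?total $ 0 = a" "?total $ 1 = b" "?total $ 2 = d"
      by (simp_all add: idx a_def b_def d_def m numeral_2_eq_2 cong: sum.cong)
    have nonneg: "0 \<le> a" "0 \<le> b" "0 \<le> d"
      by (simp_all add: a_def b_def d_def sum_nonneg viol(2))
    have "mpnn_eval ([M], input_layer n # readout) G = nn_eval (input_layer n # readout) ?total"
      using R(2)[of n] by (simp add: mpnn_eval_def m_def)
    also have "\<dots> = nn_eval readout (vec_of_list [real n, a, b, d])"
      using total nonneg abd by (simp add: nn_eval_def layer_eval_input_layer del: vec_of_list_Cons)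
    also have "\<dots> = outputs (map (\<lambda>f u. relu (f u)) [deviation, \<lambda>_. 0]) (vec_of_list [real n, a, b, d])"
      using realizes_readout carrier_vecI[of "vec_of_list [real n, a, b, d]" 4] by (simp add: realizes_def)
    finally have out: "mpnn_eval ([M], input_layer n # readout) G =
        outputs (map (\<lambda>f u. relu (f u)) [deviation, \<lambda>_. 0]) (vec_of_list [real n, a, b, d])" .
    have dev: "deviation (vec_of_list [real n, a, b, d]) = a + \<bar>b - 1\<bar> + \<bar>d - real n\<bar>"
      by (simp add: deviation_def numeral_3_eq_3 numeral_2_eq_2)
    \<comment> \<open>With two coordinates, having a strict maximum just means being
      different.\<close>
    have sem: "x \<in> class_sem {0, 1} \<longleftrightarrow> x $ 0 \<noteq> x $ 1" for x
      by (auto simp: class_sem_def insert_Diff_if)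
    have "mpnn_eval ([M], input_layer n # readout) G \<in> class_sem {0, 1} \<longleftrightarrow>
        a + \<bar>b - 1\<bar> + \<bar>d - real n\<bar> \<noteq> 0"
      unfolding out sem using nonneg(1) by (simp add: dev del: vec_of_list_Cons)
    also have "\<dots> \<longleftrightarrow> \<not> (a = 0 \<and> b = 1 \<and> d = real n)" using nonneg(1) by auto
    also have "a = 0 \<and> b = 1 \<and> d = real n \<longleftrightarrow> encodes_input G n"
    proof -
      have "a = 0 \<longleftrightarrow> (\<forall>v \<in> nodes G. node_ok (coords G v) (neigh_sum G v))"
        using fin viol u by (simp add: a_def sum_nonneg_eq_0_iff)
      \<comment> \<open>ReLU may alter root flags and inputs of bad nodes, but then a is positive
        anyway. If all nodes are good, these coordinates are nonnegative.\<close>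
      moreover have "b = (\<Sum>v \<in> nodes G. coords G v root)" "d = (\<Sum>v \<in> nodes G. coords G v arg)"
        if ok: "\<forall>v \<in> nodes G. node_ok (coords G v) (neigh_sum G v)"
      proof -
        have "0 \<le> coords G v root \<and> 0 \<le> coords G v arg" if "v \<in> nodes G" for v
          using ok that by (auto simp: node_ok_def root_ok_def)
        then show "b = (\<Sum>v \<in> nodes G. coords G v root)" "d = (\<Sum>v \<in> nodes G. coords G v arg)"
          by (simp_all add: b_def d_def)
      qed
      ultimately show ?thesis by (auto simp: encodes_input_def)
    qed
    finally show ?thesis .
  qed
  show ?thesis
    using M' R eval by (intro exI[of _ M] allI) (simp add: is_mpnn_def mpnn_in_def mpnn_out_def)
qed

end


section \<open>Reduction from halting and self-application\<close>

lemma ex_mpnn_halts: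
  assumes "infinite (UNIV :: 'v set)" and \<phi>: "\<forall>m G. labelled_graph m G \<longrightarrow> G \<in> gsem \<phi>"
  shows "\<exists>M. \<forall>n. is_mpnn ([M], input_layer n # readout) \<and>
    mpnn_out ([M], input_layer n # readout) = 2 \<and>
    (arp_holds (gsem :: 's \<Rightarrow> 'v graph set) class_sem (([M], input_layer n # readout), \<phi>, {0, 1}) \<longleftrightarrow>
      \<not> halts (P, (\<lambda>_. 0)(0 := n)))"
proof -
  \<comment> \<open>Register 0 is included because it receives the input, whether or not the program
    mentions it.\<close>
  obtain R where R: "\<forall>r \<in> insert 0 (regs P). r < R"
    using finite_nat_set_iff_bounded[of "insert 0 (regs P)"] finite_regs[of P] by blast
  obtain idx :: "com list \<Rightarrow> nat" where "inj_on idx (conts P)"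
    using finite_imp_inj_to_nat_seg[OF finite_conts] by blast
  then interpret machine P R idx
    using R by unfold_locales auto
  obtain M where M: "\<And>n. is_mpnn ([M], input_layer n # readout)"
    "\<And>n. mpnn_in ([M], input_layer n # readout) = dim" "\<And>n. mpnn_out ([M], input_layer n # readout) = 2"
    "\<And>n (G :: 'v graph). labelled_graph dim G \<Longrightarrow>
      mpnn_eval ([M], input_layer n # readout) G \<in> class_sem {0, 1} \<longleftrightarrow> \<not> encodes_input G n"
    using ex_mpnn by blast
  have "arp_holds gsem class_sem (([M], input_layer n # readout), \<phi>, {0, 1}) \<longleftrightarrow>
      \<not> halts (P, (\<lambda>_. 0)(0 := n))" for n
  proof -
    have "arp_holds gsem class_sem (([M], input_layer n # readout), \<phi>, {0, 1}) \<longleftrightarrow>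
        (\<forall>G :: 'v graph. labelled_graph dim G \<longrightarrow> \<not> encodes_input G n)"
      using M(2,4) \<phi> by (simp add: arp_holds_def)
    then show ?thesis
      using encodes_input_halts[of _ n] halts_encodes_input[OF assms(1), of n] by blast
  qed
  then show ?thesis using M(1,3) by blast
qed

theorem corollary1:
  fixes \<Phi>_unb :: "'s set"
    and gsem :: "'s \<Rightarrow> 'v graph set"
    and gcode :: "'s \<Rightarrow> nat"
  assumes "infinite (UNIV :: 'v set)"
    and "\<exists>\<phi> \<in> \<Phi>_unb. \<forall>n G. labelled_graph n G \<longrightarrow> G \<in> gsem \<phi>"
  shows "\<not> formally_verifiable gsem gcode class_sem set_encode (ARP_graph \<Phi>_unb \<Psi>_class)"
proof
  assume "formally_verifiable gsem gcode class_sem set_encode (ARP_graph \<Phi>_unb \<Psi>_class)"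
  then obtain f where f: "\<And>a. a \<in> ARP_graph \<Phi>_unb \<Psi>_class \<Longrightarrow>
      evaluates f [arp_code gcode set_encode a] (if arp_holds gsem class_sem a then 1 else 0)"
    by (auto simp: formally_verifiable_def decidable_on_def)
  obtain \<phi> where \<phi>: "\<phi> \<in> \<Phi>_unb" "\<forall>m G. labelled_graph m G \<longrightarrow> G \<in> gsem \<phi>"
    using assms(2) by blast
  let ?inst = "\<lambda>M n. (([M], input_layer n # readout), \<phi>, {0, 1 :: nat})"
  define code where "code p = prod_encode (prod_encode (p, nn_code (input_layer p # readout)),
    prod_encode (gcode \<phi>, set_encode {0, 1}))" for p
  obtain e where e: "\<And>p. evaluates e [p] (code p)"
    using computable_code[of readout] by (auto simp: computable_def code_def)
  \<comment> \<open>The input is in register 0 and the answer y appears in register 1. It is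
    replaced by 1 - y, and the empty loop runs forever unless this is 0. So the program halts iff y
    = 1.\<close>
  define P where "P = compile (Comp f [e]) [0] 1 @ [Upd 1 (- 1) 1 1, While 1 []]"
  obtain M where M: "\<And>n. is_mpnn ([M], input_layer n # readout)"
    "\<And>n. mpnn_out ([M], input_layer n # readout) = 2"
    "\<And>n. arp_holds gsem class_sem (?inst M n) \<longleftrightarrow> \<not> halts (P, (\<lambda>_. 0)(0 := n))"
    using ex_mpnn_halts[where gsem = gsem and \<phi> = \<phi> and P = P, OF assms(1) \<phi>(2)] by blast
  \<comment> \<open>\<open>mpnn_code\<close> encodes the list of message-passing networks, hence the
    singleton list. With this p, \<open>code p\<close> is the code of the instance whose bias is
    p.\<close>
  define p where "p = list_encode [nn_code M]"
  define s :: "nat \<Rightarrow> nat" where "s = (\<lambda>_. 0)(0 := p)"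
  define y where "y = (if arp_holds gsem class_sem (?inst M p) then 1 else 0 :: nat)"
  have "?inst M p \<in> ARP_graph \<Phi>_unb \<Psi>_class"
    using M(1,2)[of p] \<phi>(1) by (auto simp: ARP_graph_def \<Psi>_class_def)
  from f[OF this] have "evaluates f [code p] y"
    by (simp add: y_def code_def p_def arp_code_def mpnn_code_def)
  then have "evaluates (Comp f [e]) (map s [0]) y"
    using e by (intro evaluates.comp[where ys = "[code p]"]) (auto simp: s_def)
  then have "computes (compile (Comp f [e]) [0] 1) 1 s y"
    by (rule compile_computes) simp
  then obtain s' where s': "leads_to (compile (Comp f [e]) [0] 1) s s'" "s' 1 = y"
    by (auto simp: computes_def)
  have "halts (P, s) \<longleftrightarrow> halts ([Upd 1 (- 1) 1 1, While 1 []], s')"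
    using s'(1) by (simp only: P_def leads_to_def)
  also have "\<dots> \<longleftrightarrow> halts ([While 1 []], s'(1 := 1 - y))"
    using s'(2) by (auto simp: y_def)
  also have "\<dots> \<longleftrightarrow> y = 1"
  proof (cases "y = 1")
    case True
    then show ?thesis by (simp add: halts_While)
  next
    case False
    then have "y = 0" by (simp add: y_def split: if_splits)
    then show ?thesis using not_halts_loop[of "s'(1 := 1 - y)" 1 "[]"] by simp
  qed
  \<comment> \<open>The property holds iff y = 1, that is, iff the program halts on p; by
    construction of \<open>M\<close> it holds iff the program does not halt on p.\<close>
  finally show False using M(3)[of p] by (simp add: y_def s_def split: if_splits)
qed

end
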